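(* Let $k$ be an algebraically closed field and $q$ a prime number different from the characteristic of $k$. Let $f$ and $g$ be nonzero irreducible elements of $k[x][[y]]$, the ring of power series in $y$ with coefficients that are polynomials in $x$. If $f$ is a $q$th power modulo $g$, then the residue class of $g$ is a $q$th power in the normalization of $k[x][[y]]/(f)$. There exist functions $s$, $t$ in the field of fractions of $k[x][[y]]$ satisfying $g - s^q = ft$.
   Context: "$f$ is a $q$th power modulo $g$" means there is $h\in k[x][[y]]$ with $f-h^q\in g\,k[x][[y]]$. The normalization of the domain $k[x][[y]]/(f)$ is its integral closure in its field of fractions. The final sentence of the claim is asserted under the same hypothesis that $f$ is a $q$th power modulo $g$. *)

theory Defs
  imports "HOL-Algebra.Algebraic_Closure_Type" "HOL-Computational_Algebra.Fraction_Field"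
begin

text \<open>
  The ring \<open>k[x][[y]]\<close> is the type \<open>'k poly fps\<close>. Its quotients depend on a term, so they are
  formed with the carrier-based rings of \<open>HOL-Algebra\<close>, starting from \<open>ring_of_type_algebra\<close>.
  Neither library has the field of fractions of a carrier-based domain or the integral closure
  of a subring; they are defined here.
\<close>

definition frac_pairs :: "('a, 'm) ring_scheme \<Rightarrow> ('a \<times> 'a) set" where
  "frac_pairs D = carrier D \<times> (carrier D - {\<zero>\<^bsub>D\<^esub>})"

definition frac_rel :: "('a, 'm) ring_scheme \<Rightarrow> (('a \<times> 'a) \<times> ('a \<times> 'a)) set" where
  "frac_rel D = {((a, b), (c, d)). (a, b) \<in> frac_pairs D \<and> (c, d) \<in> frac_pairs D \<and>
                   a \<otimes>\<^bsub>D\<^esub> d = c \<otimes>\<^bsub>D\<^esub> b}"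

definition fraction :: "('a, 'm) ring_scheme \<Rightarrow> 'a \<Rightarrow> 'a \<Rightarrow> ('a \<times> 'a) set" where
  "fraction D a b = frac_rel D `` {(a, b)}"

definition fraction_field :: "('a, 'm) ring_scheme \<Rightarrow> (('a \<times> 'a) set) ring" where
  "fraction_field D =
    \<lparr>carrier = frac_pairs D // frac_rel D,
     monoid.mult = (\<lambda>U V. \<Union>(a, b)\<in>U. \<Union>(c, d)\<in>V. fraction D (a \<otimes>\<^bsub>D\<^esub> c) (b \<otimes>\<^bsub>D\<^esub> d)),
     one = fraction D \<one>\<^bsub>D\<^esub> \<one>\<^bsub>D\<^esub>,
     ring.zero = fraction D \<zero>\<^bsub>D\<^esub> \<one>\<^bsub>D\<^esub>,
     add = (\<lambda>U V. \<Union>(a, b)\<in>U. \<Union>(c, d)\<in>V.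
              fraction D (a \<otimes>\<^bsub>D\<^esub> d \<oplus>\<^bsub>D\<^esub> c \<otimes>\<^bsub>D\<^esub> b) (b \<otimes>\<^bsub>D\<^esub> d))\<rparr>"

definition frac_embed :: "('a, 'm) ring_scheme \<Rightarrow> 'a \<Rightarrow> ('a \<times> 'a) set" where
  "frac_embed D a = fraction D a \<one>\<^bsub>D\<^esub>"

definition integral_over :: "('a, 'm) ring_scheme \<Rightarrow> 'a set \<Rightarrow> 'a \<Rightarrow> bool" where
  "integral_over R A z \<longleftrightarrow> z \<in> carrier R \<and>
     (\<exists>(n::nat) c. c \<in> {..<n} \<rightarrow> A \<and>
        z [^]\<^bsub>R\<^esub> n \<oplus>\<^bsub>R\<^esub> (\<Oplus>\<^bsub>R\<^esub>i\<in>{..<n}. c i \<otimes>\<^bsub>R\<^esub> z [^]\<^bsub>R\<^esub> i) = \<zero>\<^bsub>R\<^esub>)"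

definition normalization :: "('a, 'm) ring_scheme \<Rightarrow> (('a \<times> 'a) set) ring" where
  "normalization D = (fraction_field D)
     \<lparr>carrier := {z. integral_over (fraction_field D) (frac_embed D ` carrier D) z}\<rparr>"

definition quotient_by :: "'a::comm_ring_1 \<Rightarrow> ('a set) ring" where
  "quotient_by f = ring_of_type_algebra Quot (PIdl\<^bsub>ring_of_type_algebra\<^esub> f)"

definition residue_class :: "'a::comm_ring_1 \<Rightarrow> 'a \<Rightarrow> 'a set" where
  "residue_class f g = PIdl\<^bsub>ring_of_type_algebra\<^esub> f +>\<^bsub>ring_of_type_algebra\<^esub> g"


context domain
begin

lemma frac_pairs_iff: "(a, b) \<in> frac_pairs R \<longleftrightarrow> a \<in> carrier R \<and> b \<in> carrier R \<and> b \<noteq> \<zero>"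
  by (auto simp: frac_pairs_def)

lemma equiv_frac_rel: "equiv (frac_pairs R) (frac_rel R)"
proof (rule equivI)
  show "frac_rel R \<subseteq> frac_pairs R \<times> frac_pairs R"
    by (auto simp: frac_rel_def)
  show "refl_on (frac_pairs R) (frac_rel R)"
    by (auto simp: refl_on_def frac_rel_def)
  show "sym (frac_rel R)"
    by (auto simp: sym_def frac_rel_def)
  show "trans (frac_rel R)"
  proof (rule transI, clarify)
    fix a b c d e f
    assume 1: "((a, b), (c, d)) \<in> frac_rel R" and 2: "((c, d), (e, f)) \<in> frac_rel R"
    then have car: "a \<in> carrier R" "b \<in> carrier R" "c \<in> carrier R" "d \<in> carrier R"
        "e \<in> carrier R" "f \<in> carrier R" "d \<noteq> \<zero>"
      and eq: "a \<otimes> d = c \<otimes> b" "c \<otimes> f = e \<otimes> d"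
      by (auto simp: frac_rel_def frac_pairs_iff)
    have "d \<otimes> (a \<otimes> f) = (a \<otimes> d) \<otimes> f" using car by algebra
    also have "\<dots> = (c \<otimes> f) \<otimes> b" unfolding eq(1) using car by algebra
    also have "\<dots> = d \<otimes> (e \<otimes> b)" unfolding eq(2) using car by algebra
    finally have "a \<otimes> f = e \<otimes> b" using car m_lcancel by simp
    with 1 2 show "((a, b), (e, f)) \<in> frac_rel R" by (auto simp: frac_rel_def)
  qed
qed

lemma frac_eq_iff:
  assumes "(a, b) \<in> frac_pairs R" "(c, d) \<in> frac_pairs R"
  shows "fraction R a b = fraction R c d \<longleftrightarrow> a \<otimes> d = c \<otimes> b"
  unfolding fraction_def using eq_equiv_class_iff[OF equiv_frac_rel assms] assms
  by (auto simp: frac_rel_def)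

lemma frac_in_carrier: "(a, b) \<in> frac_pairs R \<Longrightarrow> fraction R a b \<in> carrier (fraction_field R)"
  by (auto simp: fraction_field_def fraction_def quotient_def)

lemma fraction_field_cases:
  assumes "U \<in> carrier (fraction_field R)"
  obtains a b where "(a, b) \<in> frac_pairs R" "U = fraction R a b"
  using assms by (auto simp: fraction_field_def fraction_def elim!: quotientE)

lemma frac_mult:
  assumes "(a, b) \<in> frac_pairs R" "(c, d) \<in> frac_pairs R"
  shows "fraction R a b \<otimes>\<^bsub>fraction_field R\<^esub> fraction R c d = fraction R (a \<otimes> c) (b \<otimes> d)"
proof -
  let ?f = "\<lambda>p q. fraction R (fst p \<otimes> fst q) (snd p \<otimes> snd q)"
  have "congruent2 (frac_rel R) (frac_rel R) ?f"
  proof (rule congruent2I[OF equiv_frac_rel equiv_frac_rel], goal_cases)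
    case (1 p q z)
    obtain a b c d e f where [simp]: "p = (a, b)" "q = (c, d)" "z = (e, f)"
      by (cases p, cases q, cases z)
    from 1 have car: "a \<in> carrier R" "b \<in> carrier R" "c \<in> carrier R" "d \<in> carrier R"
        "e \<in> carrier R" "f \<in> carrier R" "b \<noteq> \<zero>" "d \<noteq> \<zero>" "f \<noteq> \<zero>" and eq: "a \<otimes> d = c \<otimes> b"
      by (auto simp: frac_rel_def frac_pairs_iff)
    have "(a \<otimes> e) \<otimes> (d \<otimes> f) = (a \<otimes> d) \<otimes> (e \<otimes> f)" using car by algebra
    also have "\<dots> = (c \<otimes> e) \<otimes> (b \<otimes> f)" unfolding eq using car by algebra
    finally show ?case using car by (simp add: frac_eq_iff frac_pairs_iff integral_iff)
  next
    case (2 p q z)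
    obtain a b c d e f where [simp]: "p = (a, b)" "q = (c, d)" "z = (e, f)"
      by (cases p, cases q, cases z)
    from 2 have car: "a \<in> carrier R" "b \<in> carrier R" "c \<in> carrier R" "d \<in> carrier R"
        "e \<in> carrier R" "f \<in> carrier R" "b \<noteq> \<zero>" "d \<noteq> \<zero>" "f \<noteq> \<zero>" and eq: "a \<otimes> d = c \<otimes> b"
      by (auto simp: frac_rel_def frac_pairs_iff)
    have "(e \<otimes> a) \<otimes> (f \<otimes> d) = (a \<otimes> d) \<otimes> (e \<otimes> f)" using car by algebra
    also have "\<dots> = (e \<otimes> c) \<otimes> (f \<otimes> b)" unfolding eq using car by algebra
    finally show ?case using car by (simp add: frac_eq_iff frac_pairs_iff integral_iff)
  qed
  from UN_equiv_class2[OF equiv_frac_rel equiv_frac_rel this assms]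
  show ?thesis by (simp add: fraction_field_def fraction_def case_prod_beta)
qed

lemma frac_add:
  assumes "(a, b) \<in> frac_pairs R" "(c, d) \<in> frac_pairs R"
  shows "fraction R a b \<oplus>\<^bsub>fraction_field R\<^esub> fraction R c d = fraction R (a \<otimes> d \<oplus> c \<otimes> b) (b \<otimes> d)"
proof -
  let ?f = "\<lambda>p q. fraction R (fst p \<otimes> snd q \<oplus> fst q \<otimes> snd p) (snd p \<otimes> snd q)"
  have "congruent2 (frac_rel R) (frac_rel R) ?f"
  proof (rule congruent2I[OF equiv_frac_rel equiv_frac_rel], goal_cases)
    case (1 p q z)
    obtain a b c d e f where [simp]: "p = (a, b)" "q = (c, d)" "z = (e, f)"
      by (cases p, cases q, cases z)
    from 1 have car: "a \<in> carrier R" "b \<in> carrier R" "c \<in> carrier R" "d \<in> carrier R"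
        "e \<in> carrier R" "f \<in> carrier R" "b \<noteq> \<zero>" "d \<noteq> \<zero>" "f \<noteq> \<zero>" and eq: "a \<otimes> d = c \<otimes> b"
      by (auto simp: frac_rel_def frac_pairs_iff)
    have "(a \<otimes> f \<oplus> e \<otimes> b) \<otimes> (d \<otimes> f) = (a \<otimes> d) \<otimes> (f \<otimes> f) \<oplus> e \<otimes> b \<otimes> d \<otimes> f"
      using car by algebra
    also have "\<dots> = (c \<otimes> f \<oplus> e \<otimes> d) \<otimes> (b \<otimes> f)" unfolding eq using car by algebra
    finally show ?case using car by (simp add: frac_eq_iff frac_pairs_iff integral_iff)
  next
    case (2 p q z)
    obtain a b c d e f where [simp]: "p = (a, b)" "q = (c, d)" "z = (e, f)"
      by (cases p, cases q, cases z)
    from 2 have car: "a \<in> carrier R" "b \<in> carrier R" "c \<in> carrier R" "d \<in> carrier R"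
        "e \<in> carrier R" "f \<in> carrier R" "b \<noteq> \<zero>" "d \<noteq> \<zero>" "f \<noteq> \<zero>" and eq: "a \<otimes> d = c \<otimes> b"
      by (auto simp: frac_rel_def frac_pairs_iff)
    have "(e \<otimes> b \<oplus> a \<otimes> f) \<otimes> (f \<otimes> d) = (a \<otimes> d) \<otimes> (f \<otimes> f) \<oplus> e \<otimes> b \<otimes> d \<otimes> f"
      using car by algebra
    also have "\<dots> = (e \<otimes> d \<oplus> c \<otimes> f) \<otimes> (f \<otimes> b)" unfolding eq using car by algebra
    finally show ?case using car by (simp add: frac_eq_iff frac_pairs_iff integral_iff)
  qed
  from UN_equiv_class2[OF equiv_frac_rel equiv_frac_rel this assms]
  show ?thesis by (simp add: fraction_field_def fraction_def case_prod_beta)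
qed

lemma fraction_field_one: "\<one>\<^bsub>fraction_field R\<^esub> = fraction R \<one> \<one>"
  and fraction_field_zero: "\<zero>\<^bsub>fraction_field R\<^esub> = fraction R \<zero> \<one>"
  by (simp_all add: fraction_field_def)

lemmas frac_simps =
  frac_mult frac_add fraction_field_one fraction_field_zero frac_eq_iff frac_pairs_iff integral_iff

lemma field_fraction_field: "field (fraction_field R)"
proof (rule cring.cring_fieldI2)
  let ?K = "fraction_field R"
  show "cring ?K"
  proof (rule cringI)
    show "abelian_group ?K"
    proof (rule abelian_groupI)
      fix U V W assume U: "U \<in> carrier ?K" and V: "V \<in> carrier ?K" and W: "W \<in> carrier ?K"
      then show "(U \<oplus>\<^bsub>?K\<^esub> V) \<oplus>\<^bsub>?K\<^esub> W = U \<oplus>\<^bsub>?K\<^esub> (V \<oplus>\<^bsub>?K\<^esub> W)"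
        by (elim fraction_field_cases) (clarsimp simp: frac_simps, algebra)
    next
      fix U V assume U: "U \<in> carrier ?K" and V: "V \<in> carrier ?K"
      then show "U \<oplus>\<^bsub>?K\<^esub> V = V \<oplus>\<^bsub>?K\<^esub> U"
        by (elim fraction_field_cases) (clarsimp simp: frac_simps, algebra)
      from U V show "U \<oplus>\<^bsub>?K\<^esub> V \<in> carrier ?K"
        by (elim fraction_field_cases) (auto simp: frac_simps intro!: frac_in_carrier)
    next
      show "\<zero>\<^bsub>?K\<^esub> \<in> carrier ?K"
        by (auto simp: frac_simps intro!: frac_in_carrier)
    next
      fix U assume U: "U \<in> carrier ?K"
      then show "\<zero>\<^bsub>?K\<^esub> \<oplus>\<^bsub>?K\<^esub> U = U"
        by (elim fraction_field_cases) (clarsimp simp: frac_simps)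
      from U obtain a b where ab: "(a, b) \<in> frac_pairs R" "U = fraction R a b"
        by (rule fraction_field_cases)
      then have "fraction R (\<ominus> a) b \<oplus>\<^bsub>?K\<^esub> U = \<zero>\<^bsub>?K\<^esub>"
        by (clarsimp simp: frac_simps, algebra)
      moreover have "fraction R (\<ominus> a) b \<in> carrier ?K"
        using ab by (auto simp: frac_pairs_iff intro!: frac_in_carrier)
      ultimately show "\<exists>V\<in>carrier ?K. V \<oplus>\<^bsub>?K\<^esub> U = \<zero>\<^bsub>?K\<^esub>" by blast
    qed
    show "comm_monoid ?K"
    proof (rule comm_monoidI)
      fix U V W assume U: "U \<in> carrier ?K" and V: "V \<in> carrier ?K" and W: "W \<in> carrier ?K"
      then show "(U \<otimes>\<^bsub>?K\<^esub> V) \<otimes>\<^bsub>?K\<^esub> W = U \<otimes>\<^bsub>?K\<^esub> (V \<otimes>\<^bsub>?K\<^esub> W)"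
        by (elim fraction_field_cases) (clarsimp simp: frac_simps, algebra)
    next
      fix U V assume U: "U \<in> carrier ?K" and V: "V \<in> carrier ?K"
      then show "U \<otimes>\<^bsub>?K\<^esub> V = V \<otimes>\<^bsub>?K\<^esub> U"
        by (elim fraction_field_cases) (clarsimp simp: frac_simps, algebra)
      from U V show "U \<otimes>\<^bsub>?K\<^esub> V \<in> carrier ?K"
        by (elim fraction_field_cases) (auto simp: frac_simps intro!: frac_in_carrier)
    next
      show "\<one>\<^bsub>?K\<^esub> \<in> carrier ?K"
        by (auto simp: frac_simps intro!: frac_in_carrier)
    next
      fix U assume U: "U \<in> carrier ?K"
      then show "\<one>\<^bsub>?K\<^esub> \<otimes>\<^bsub>?K\<^esub> U = U"
        by (elim fraction_field_cases) (clarsimp simp: frac_simps)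
    qed
    fix U V W assume U: "U \<in> carrier ?K" and V: "V \<in> carrier ?K" and W: "W \<in> carrier ?K"
    then show "(U \<oplus>\<^bsub>?K\<^esub> V) \<otimes>\<^bsub>?K\<^esub> W = U \<otimes>\<^bsub>?K\<^esub> W \<oplus>\<^bsub>?K\<^esub> V \<otimes>\<^bsub>?K\<^esub> W"
      by (elim fraction_field_cases) (clarsimp simp: frac_simps, algebra)
  qed
  show "\<zero>\<^bsub>?K\<^esub> \<noteq> \<one>\<^bsub>?K\<^esub>" by (simp add: frac_simps)
  fix U assume "U \<in> carrier ?K" "U \<noteq> \<zero>\<^bsub>?K\<^esub>"
  then obtain a b where ab: "(a, b) \<in> frac_pairs R" "U = fraction R a b" "a \<noteq> \<zero>"
    by (elim fraction_field_cases) (auto simp: frac_simps)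
  then have "U \<otimes>\<^bsub>?K\<^esub> fraction R b a = \<one>\<^bsub>?K\<^esub>"
    by (clarsimp simp: frac_simps, algebra)
  moreover have "fraction R b a \<in> carrier ?K"
    using ab by (auto simp: frac_pairs_iff intro!: frac_in_carrier)
  ultimately show "\<exists>V\<in>carrier ?K. U \<otimes>\<^bsub>?K\<^esub> V = \<one>\<^bsub>?K\<^esub>" by blast
qed

lemma frac_embed_hom: "frac_embed R \<in> ring_hom R (fraction_field R)"
  by (rule ring_hom_memI) (auto simp: frac_embed_def frac_simps intro!: frac_in_carrier)

lemma inj_on_frac_embed: "inj_on (frac_embed R) (carrier R)"
  by (auto simp: inj_on_def frac_embed_def frac_simps)

end

end

theory Submission
  imports Defs
begin

text \<open>
  A root of \<open>X\<^sup>q - g\<close> in the field of fractions of \<open>k[x][[y]]/(f)\<close> is integral over that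
  quotient, the polynomial being monic. So the first assertion asks for \<open>a\<close> and \<open>b\<close> with
  \<open>f\<close> not dividing \<open>b\<close> and \<open>f\<close> dividing \<open>g b\<^sup>q - a\<^sup>q\<close>
  (\<open>root_in_normalization\<close>, \<open>power_reciprocity\<close>). The second assertion holds with \<open>s = 0\<close> and
  \<open>t = g/f\<close>.

  The reason for the first assertion is the symmetry of intersection numbers. Suppose that
  \<open>f(x,0)\<close> is not zero. Then \<open>f\<close> is a single analytic branch: the field of fractions \<open>K\<close> of
  \<open>k[x][[y]]/(f)\<close> carries a discrete valuation with residue field \<open>k\<close>, and its value at the class
  of \<open>a\<close> is the intersection number \<open>dim k[x][[y]]/(f,a)\<close>. As \<open>k\<close> is algebraically closed and
  \<open>q\<close> is invertible in \<open>k\<close>, elements of value \<open>0\<close> are \<open>q\<close>-th powers, and therefore an element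
  of \<open>K\<close> is a \<open>q\<close>-th power as soon as its value is divisible by \<open>q\<close>
  (\<open>power_residue_if_len_dvd\<close>). Now
  \<open>dim k[x][[y]]/(f,g) = dim k[x][[y]]/(g,f) = dim k[x][[y]]/(g,h\<^sup>q) = q dim k[x][[y]]/(g,h)\<close>,
  because \<open>f\<close> and \<open>h\<^sup>q\<close> agree modulo \<open>g\<close> and codimension is additive in the second generator
  (\<open>codim_power\<close>). If \<open>f(x,0) = 0\<close>, then \<open>f\<close> is associated to \<open>y\<close>, the quotient is \<open>k[x]\<close>, and
  Hensel's lemma makes \<open>g(x,0)\<close> a constant times a power of a linear polynomial, whose exponent is
  the same intersection number and hence divisible by \<open>q\<close>. These numbers are finite unless \<open>f\<close>
  divides \<open>g\<close>, and then the class of \<open>g\<close> is \<open>0\<close>.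

  The valuation is obtained from these codimensions, uniformly in the characteristic.
  The codimension extends to a homomorphism from the nonzero elements of \<open>K\<close> to the integers.
  Applied to a primitive polynomial of least degree over \<open>k[[y]]\<close> that vanishes at a given element
  of \<open>K\<close>, Hensel's lemma shows that this element or its inverse is a constant plus a topologically
  nilpotent element (\<open>residue_dichotomy\<close>); the latter have positive value, and a nonzero constant
  plus a topologically nilpotent element has a \<open>q\<close>-th root by a truncated binomial series
  (\<open>root_of_const_plus_small\<close>). What remains is that the value \<open>1\<close> occurs
  (\<open>uniformizer_exists\<close>). Let \<open>n\<close> be the degree of \<open>f(x,0)\<close>, which is also the value of \<open>y\<close>,
  and let \<open>p\<close> have the least positive value \<open>d\<close>. Expanding in digits along \<open>p\<close> shows that
  \<open>n/d\<close> powers of \<open>p\<close> span the valuation ring over \<open>k[[y]]\<close>; but \<open>1, x, ..., x\<^bsup>n-1\<^esup>\<close> lie in it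
  and are linearly independent by Weierstrass division, so \<open>d = 1\<close>.

  The field \<open>K\<close> depends on \<open>f\<close>. To calculate in a type, one maps \<open>k[x][[y]]\<close> with kernel \<open>(f)\<close> to
  an algebraic closure of the fraction field of \<open>k[[y]]\<close>, sending \<open>x\<close> to a root of the Weierstrass
  polynomial of \<open>f\<close> (\<open>branch_exists\<close>).
\<close>

section \<open>Ring homomorphisms and linear relations\<close>

locale unital_hom =
  fixes h :: "'a::comm_ring_1 \<Rightarrow> 'b::comm_ring_1"
  assumes hom_add: "h (a + b) = h a + h b"
    and hom_mult: "h (a * b) = h a * h b"
    and hom_one: "h 1 = 1"
begin

lemma hom_zero: "h 0 = 0"
  using hom_add[of 0 0] by simp

lemma hom_uminus: "h (- a) = - h a"
  using hom_add[of a "- a"] by (simp add: hom_zero eq_neg_iff_add_eq_0 add.commute)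

lemma hom_diff: "h (a - b) = h a - h b"
  using hom_add[of a "- b"] by (simp add: hom_uminus)

lemma hom_power: "h (a ^ m) = h a ^ m"
  by (induction m) (simp_all add: hom_one hom_mult)

lemma hom_sum: "h (sum F I) = (\<Sum>i\<in>I. h (F i))"
  by (induction I rule: infinite_finite_induct) (simp_all add: hom_zero hom_add)

lemmas hom_simps = hom_add hom_mult hom_one hom_zero hom_uminus hom_diff hom_power hom_sum

definition ev :: "'b \<Rightarrow> 'a poly \<Rightarrow> 'b" where
  "ev z P = poly (map_poly h P) z"

lemma ev_add: "ev z (P + Q) = ev z P + ev z Q"
proof -
  have "map_poly h (P + Q) = map_poly h P + map_poly h Q"
    by (rule poly_eqI) (simp add: coeff_map_poly hom_zero hom_add)
  thus ?thesis by (simp add: ev_def)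
qed

lemma ev_smult: "ev z (smult c P) = h c * ev z P"
proof -
  have "map_poly h (smult c P) = smult (h c) (map_poly h P)"
    by (rule poly_eqI) (simp add: coeff_map_poly hom_zero hom_mult)
  thus ?thesis by (simp add: ev_def)
qed

lemma ev_0: "ev z 0 = 0"
  by (simp add: ev_def)

lemma ev_pCons: "ev z (pCons c P) = h c + z * ev z P"
proof -
  have "map_poly h (pCons c P) = pCons (h c) (map_poly h P)"
    by (rule poly_eqI) (simp add: coeff_map_poly coeff_pCons hom_zero split: nat.splits)
  thus ?thesis by (simp add: ev_def)
qed

lemma ev_1: "ev z 1 = 1"
  by (simp add: one_pCons ev_pCons ev_0 hom_one)

lemma ev_mult: "ev z (P * Q) = ev z P * ev z Q"
  by (induction P) (simp_all add: ev_0 ev_pCons ev_add ev_smult hom_zero algebra_simps)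

lemma unital_hom_ev: "unital_hom (ev z)"
  by unfold_locales (simp_all add: ev_add ev_mult ev_1)

lemmas ev_diff = unital_hom.hom_diff[OF unital_hom_ev]
  and ev_power = unital_hom.hom_power[OF unital_hom_ev]
  and ev_sum = unital_hom.hom_sum[OF unital_hom_ev]

lemma ev_monom: "ev z (monom c i) = h c * z ^ i"
  by (induction i) (simp_all add: monom_0 monom_Suc ev_pCons ev_0 hom_zero)

lemma ev_as_sum:
  assumes "degree P < N"
  shows "ev z P = (\<Sum>i<N. h (coeff P i) * z ^ i)"
proof -
  have "P = (\<Sum>i<N. monom (coeff P i) i)"
    by (rule poly_eqI) (use assms in \<open>auto simp: coeff_sum coeff_eq_0\<close>)
  hence "ev z P = ev z (\<Sum>i<N. monom (coeff P i) i)" by simp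
  thus ?thesis by (simp add: ev_sum ev_monom)
qed

lemma ev_pcompose: "ev z (pcompose P Q) = ev (ev z Q) P"
  by (induction P) (simp_all add: pcompose_pCons ev_add ev_mult ev_pCons ev_0)

end

text \<open>
  Gaussian elimination without division. The coefficients lie in a domain, so that the lemma
  applies to \<open>k[[y]]\<close> as well as to \<open>k\<close>: it gives the invariance of codimension, the algebraicity
  of the field of a branch over \<open>k[[y]]\<close>, and the comparison of the two spanning sets of its
  valuation ring.
\<close>

lemma exists_linear_relation:
  fixes m :: "nat \<Rightarrow> nat \<Rightarrow> 'a::idom"
  assumes "e < n"
  shows "\<exists>u. (\<exists>j<n. u j \<noteq> 0) \<and> (\<forall>i<e. (\<Sum>j<n. u j * m j i) = 0)"
  using assms
proof (induction e arbitrary: n m)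
  case 0
  then show ?case by (intro exI[of _ "\<lambda>_. 1"]) auto
next
  case (Suc e)
  show ?case
  proof (cases "\<forall>j<n. m j e = 0")
    case True
    from Suc.prems have "e < n" by simp
    from Suc.IH[OF this, of m] obtain u where u: "\<exists>j<n. u j \<noteq> 0" "\<forall>i<e. (\<Sum>j<n. u j * m j i) = 0"
      by blast
    from True have "(\<Sum>j<n. u j * m j e) = 0" by simp
    with u show ?thesis by (intro exI[of _ u]) (auto simp: less_Suc_eq)
  next
    case False
    then obtain p where p: "p < n" "m p e \<noteq> 0" by blast
    \<comment> \<open>The row \<open>p\<close> is the pivot; the remaining rows are enumerated by \<open>skip\<close>.\<close>
    define skip where "skip j = (if j < p then j else Suc j)" for j
    obtain n' where n': "n = Suc n'" using Suc.prems by (cases n) auto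
    have "inj_on skip {..<n'}" by (auto simp: inj_on_def skip_def split: if_splits)
    moreover have "skip ` {..<n'} \<subseteq> {..<n} - {p}" using p n' by (auto simp: skip_def)
    moreover have "card ({..<n} - {p}) = n'" using p n' by simp
    ultimately have bij: "bij_betw skip {..<n'} ({..<n} - {p})"
      unfolding bij_betw_def by (metis card_image card_lessThan card_subset_eq finite_Diff finite_lessThan)
    \<comment> \<open>The column \<open>e\<close> is cleared by cross multiplication with the pivot.\<close>
    define m' where "m' j i = m p e * m (skip j) i - m (skip j) e * m p i" for j i
    have "e < n'" using Suc.prems n' by simp
    from Suc.IH[OF this, of m'] obtain u where u: "\<exists>j<n'. u j \<noteq> 0"
      "\<forall>i<e. (\<Sum>j<n'. u j * m' j i) = 0" by blast
    define w where "w = (\<lambda>j. the_inv_into {..<n'} skip j)"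
    define U where "U j = (if j = p then - (\<Sum>j<n'. u j * m (skip j) e) else m p e * u (w j))" for j
    have skip_ne: "skip j \<noteq> p" for j by (auto simp: skip_def)
    have w_skip: "w (skip j) = j" if "j < n'" for j
      unfolding w_def using that bij by (intro the_inv_into_f_f) (auto simp: bij_betw_def)
    have sum_split: "(\<Sum>j<n. U j * m j i) = U p * m p i + (\<Sum>j<n'. U (skip j) * m (skip j) i)" for i
    proof -
      have "(\<Sum>j<n. U j * m j i) = U p * m p i + (\<Sum>j\<in>{..<n} - {p}. U j * m j i)"
        using p by (subst sum.remove[of _ p]) auto
      also have "(\<Sum>j\<in>{..<n} - {p}. U j * m j i) = (\<Sum>j<n'. U (skip j) * m (skip j) i)"
        by (rule sum.reindex_bij_betw[OF bij, symmetric])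
      finally show ?thesis .
    qed
    have val: "(\<Sum>j<n. U j * m j i) = (\<Sum>j<n'. u j * m' j i)" for i
    proof -
      have "(\<Sum>j<n'. U (skip j) * m (skip j) i) = (\<Sum>j<n'. m p e * u j * m (skip j) i)"
        by (rule sum.cong) (auto simp: U_def skip_ne w_skip)
      thus ?thesis unfolding sum_split
        by (simp add: U_def m'_def algebra_simps sum_subtractf sum_distrib_left)
    qed
    have "(\<Sum>j<n. U j * m j e) = 0" unfolding val by (simp add: m'_def mult.commute)
    with u(2) have "\<forall>i<Suc e. (\<Sum>j<n. U j * m j i) = 0" by (auto simp: val less_Suc_eq)
    moreover from u(1) obtain j where j: "j < n'" "u j \<noteq> 0" by blast
    have "U (skip j) \<noteq> 0" "skip j < n" using j p bij
      by (auto simp: U_def skip_ne w_skip bij_betw_def)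
    ultimately show ?thesis by blast
  qed
qed

section \<open>Polynomials over k[[y]] inside k[x][[y]]\<close>

definition x_const :: "'k::comm_ring_1 fps \<Rightarrow> 'k poly fps" where
  "x_const w = Abs_fps (\<lambda>j. [:fps_nth w j:])"

lemma x_const_nth [simp]: "fps_nth (x_const w) j = [:fps_nth w j:]"
  by (simp add: x_const_def)

lemma pCons_sum: "[:\<Sum>i\<in>I. F i:] = (\<Sum>i\<in>I. [:F i:])"
proof (induction I rule: infinite_finite_induct)
  case (insert x A)
  have "[:F x + sum F A:] = [:F x:] + [:sum F A:]" by simp
  with insert show ?case by (simp only: sum.insert[OF insert.hyps])
qed auto

lemma x_const_mult: "x_const (a * b) = x_const a * x_const b"
proof (rule fps_ext)
  fix n show "fps_nth (x_const (a * b)) n = fps_nth (x_const a * x_const b) n"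
    by (simp add: fps_mult_nth pCons_sum mult.commute)
qed

global_interpretation xc: unital_hom x_const
proof (unfold_locales, goal_cases)
  case (1 a b) show ?case by (rule fps_ext) simp
next
  case (2 a b) show ?case by (rule x_const_mult)
next
  case 3 show ?case by (rule fps_ext) (simp add: one_pCons)
qed

lemma x_const_X [simp]: "x_const fps_X = fps_X"
  by (rule fps_ext) (simp add: one_pCons)

abbreviation scalar :: "'k::comm_ring_1 \<Rightarrow> 'k poly fps" where
  "scalar c \<equiv> x_const (fps_const c)"

text \<open>
  The inclusion of \<open>k[[y]][x]\<close> into \<open>k[x][[y]]\<close>. Its image consists of the series whose coefficients
  have bounded degree (\<open>as_series_surj\<close>).
\<close>

definition as_series :: "'k::comm_ring_1 fps poly \<Rightarrow> 'k poly fps" where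
  "as_series = xc.ev (fps_const [:0, 1:])"

lemma as_series_coeff: "coeff (fps_nth (as_series P) j) i = fps_nth (coeff P i) j"
  unfolding as_series_def
proof (induction P arbitrary: i j)
  case 0
  show ?case by (simp add: xc.ev_0)
next
  case (pCons c P)
  have "fps_nth (xc.ev (fps_const [:0, 1:]) (pCons c P)) j
      = pCons (fps_nth c j) (fps_nth (xc.ev (fps_const [:0, 1:]) P) j)"
    by (simp add: xc.ev_pCons)
  then show ?case by (cases i) (simp_all only: coeff_pCons_0 coeff_pCons_Suc pCons.IH)
qed

global_interpretation sr: unital_hom as_series
  unfolding as_series_def by (rule xc.unital_hom_ev)

lemma as_series_smult: "as_series (smult c P) = x_const c * as_series P"
  by (simp add: as_series_def xc.ev_smult)

lemma as_series_eq_iff [simp]: "as_series P = as_series Q \<longleftrightarrow> P = Q"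
proof
  assume *: "as_series P = as_series Q"
  show "P = Q"
  proof (intro poly_eqI fps_ext)
    fix i j show "fps_nth (coeff P i) j = fps_nth (coeff Q i) j"
      using * as_series_coeff[of P j i] as_series_coeff[of Q j i] by simp
  qed
qed simp

lemma as_series_0_iff [simp]: "as_series P = 0 \<longleftrightarrow> P = 0"
  using as_series_eq_iff[of P 0] by (simp add: sr.hom_zero del: as_series_eq_iff)

lemma degree_as_series_nth: "degree (fps_nth (as_series P) j) \<le> degree P"
  by (rule degree_le) (simp add: as_series_coeff coeff_eq_0)

lemma as_series_surj:
  assumes "\<And>j. degree (fps_nth F j) \<le> N"
  obtains P where "as_series P = F" "degree P \<le> N"
proof -
  define P where "P = (\<Sum>i\<le>N. monom (Abs_fps (\<lambda>j. coeff (fps_nth F j) i)) i)"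
  have c: "coeff P i = (if i \<le> N then Abs_fps (\<lambda>j. coeff (fps_nth F j) i) else 0)" for i
    by (auto simp: P_def coeff_sum)
  have "as_series P = F"
  proof (intro fps_ext poly_eqI)
    fix j i show "coeff (fps_nth (as_series P) j) i = coeff (fps_nth F j) i"
      using assms[of j] by (auto simp: as_series_coeff c coeff_eq_0)
  qed
  moreover have "degree P \<le> N" by (rule degree_le) (simp add: c)
  ultimately show ?thesis by (rule that)
qed

lemma fps_X_times_shift:
  fixes a :: "'a::comm_ring_1 fps"
  shows "fps_nth a 0 = 0 \<Longrightarrow> fps_X * fps_shift 1 a = a"
  by (rule fps_ext) auto

lemma fps_dvd_1_iff:
  fixes a :: "'a::comm_ring_1 fps"
  shows "a dvd 1 \<longleftrightarrow> fps_nth a 0 dvd 1"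
  by (simp only: dvd_def fps_is_left_unit_iff_zeroth_is_left_unit)

text \<open>Reduction of \<open>k[[y]][x]\<close> modulo \<open>y\<close>.\<close>

definition red :: "'k::comm_ring_1 fps poly \<Rightarrow> 'k poly" where
  "red P = fps_nth (as_series P) 0"

lemma coeff_red: "coeff (red P) i = fps_nth (coeff P i) 0"
  by (simp add: red_def as_series_coeff)

lemma degree_red: "degree (red P) \<le> degree P"
  by (simp add: red_def degree_as_series_nth)

lemma red_pCons: "red (pCons a P) = pCons (fps_nth a 0) (red P)"
  by (rule poly_eqI) (simp add: coeff_red coeff_pCons split: nat.splits)

lemma red_0: "red 0 = 0"
  by (rule poly_eqI) (simp add: coeff_red)

lemma red_pcompose_linear:
  "red (pcompose P [:fps_const c, 1:]) = pcompose (red P) [:c, 1:]"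
proof (induction P)
  case (pCons a P)
  have "red (pcompose (pCons a P) [:fps_const c, 1:]) = [:fps_nth a 0:] + [:c, 1:] * red (pcompose P [:fps_const c, 1:])"
    by (rule poly_eqI) (simp add: pcompose_pCons coeff_red coeff_pCons split: nat.splits)
  thus ?case by (simp add: red_pCons pcompose_pCons pCons.IH)
qed (simp add: red_0)

text \<open>
  Extracting the largest power of \<open>y\<close> that divides all coefficients; a power series is a unit times
  a power of \<open>y\<close>, so what is left is primitive.
\<close>

lemma primitive_part_exists:
  fixes P :: "'k::idom fps poly"
  assumes "P \<noteq> 0"
  obtains r P' where "P = smult (fps_X ^ r) P'" "red P' \<noteq> 0"
proof -
  define F where "F = as_series P"
  have "F \<noteq> 0" using assms by (simp add: F_def)
  define r where "r = subdegree F"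
  have "degree (fps_nth (fps_shift r F) j) \<le> degree P" for j
    by (simp add: F_def degree_as_series_nth)
  then obtain P' where P': "as_series P' = fps_shift r F" by (rule as_series_surj)
  have "as_series P = as_series (smult (fps_X ^ r) P')"
    using subdegree_decompose[of F]
    by (simp add: as_series_smult P' xc.hom_power r_def flip: F_def) (simp add: mult.commute)
  moreover have "red P' \<noteq> 0" using \<open>F \<noteq> 0\<close> by (simp add: red_def P' r_def)
  ultimately show ?thesis using that by simp
qed

section \<open>Weierstrass division\<close>

text \<open>
  Course-of-values recursion in the form in which coefficients of a power series are determined by
  the earlier ones.
\<close>

lemma fps_recursion:
  fixes H :: "nat \<Rightarrow> (nat \<Rightarrow> 'a) \<Rightarrow> 'a"
  assumes "\<And>n c c'. (\<And>j. j < n \<Longrightarrow> c j = c' j) \<Longrightarrow> H n c = H n c'"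
  shows "\<exists>c. \<forall>n. c n = H n c"
proof -
  have "adm_wf less_than (\<lambda>c n. H n c)"
    unfolding adm_wf_def
  proof (intro allI impI)
    fix c c' :: "nat \<Rightarrow> 'a" and n assume "\<forall>j. (j, n) \<in> less_than \<longrightarrow> c j = c' j"
    then show "H n c = H n c'" by (intro assms) simp
  qed
  from wfrec_fixpoint[OF wf_less_than this] have "wfrec less_than (\<lambda>c n. H n c) n =
      H n (wfrec less_than (\<lambda>c n. H n c))" for n
    by (rule fun_cong)
  thus ?thesis by blast
qed

text \<open>
  The \<open>j\<close>-th coefficients of quotient and remainder come from dividing by \<open>f(x,0)\<close> in \<open>k[x]\<close>, once
  the contribution of the earlier coefficients of the quotient has been subtracted.
\<close>

lemma weierstrass_division:
  fixes f F :: "'k::field poly fps"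
  assumes "fps_nth f 0 \<noteq> 0"
  obtains Q R where "F = f * Q + R" "\<And>j. fps_nth R j = 0 \<or> degree (fps_nth R j) < degree (fps_nth f 0)"
proof -
  define rest where "rest n c = fps_nth F n - (\<Sum>i<n. c i * fps_nth f (n - i))" for n and c :: "nat \<Rightarrow> 'k poly"
  obtain c where c: "\<And>n. c n = rest n c div fps_nth f 0"
    using fps_recursion[of "\<lambda>n c. rest n c div fps_nth f 0"] by (auto simp: rest_def)
  define R where "R = Abs_fps (\<lambda>n. rest n c mod fps_nth f 0)"
  have "F = f * Abs_fps c + R"
  proof (rule fps_ext)
    fix n
    have "fps_nth (f * Abs_fps c) n = (\<Sum>i\<le>n. c i * fps_nth f (n - i))"
      by (subst mult.commute) (simp add: fps_mult_nth atLeast0AtMost)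
    also have "\<dots> = (\<Sum>i<n. c i * fps_nth f (n - i)) + c n * fps_nth f 0"
      by (simp add: lessThan_Suc_atMost[symmetric])
    also have "c n * fps_nth f 0 = rest n c - rest n c mod fps_nth f 0"
      unfolding c[of n] by (simp add: minus_mod_eq_div_mult)
    finally show "fps_nth F n = fps_nth (f * Abs_fps c + R) n"
      by (simp add: R_def rest_def)
  qed
  moreover have "fps_nth R j = 0 \<or> degree (fps_nth R j) < degree (fps_nth f 0)" for j
    using assms degree_mod_less[of "fps_nth f 0" "rest j c"] by (auto simp: R_def)
  ultimately show ?thesis by (rule that)
qed

text \<open>
  Uniqueness of the remainder: the lowest nonzero coefficient of a multiple of \<open>f\<close> is a multiple of
  \<open>f(x,0)\<close>.
\<close>

lemma dvd_small_degree_imp_zero: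
  fixes f R :: "'k::field poly fps"
  assumes "f dvd R" "fps_nth f 0 \<noteq> 0"
    "\<And>j. fps_nth R j = 0 \<or> degree (fps_nth R j) < degree (fps_nth f 0)"
  shows "R = 0"
proof (rule ccontr)
  assume "R \<noteq> 0"
  from assms(1) obtain Q where Q: "R = f * Q" by blast
  with \<open>R \<noteq> 0\<close> have "Q \<noteq> 0" by auto
  have s: "subdegree f = 0" using assms(2) by (simp add: subdegree_eq_0)
  define j where "j = subdegree Q"
  have "fps_nth R (subdegree f + j) = fps_nth f (subdegree f) * fps_nth Q j"
    unfolding Q j_def by simp
  hence "fps_nth R j = fps_nth f 0 * fps_nth Q j" by (simp add: s)
  moreover have "fps_nth Q j \<noteq> 0" using \<open>Q \<noteq> 0\<close> by (simp add: j_def)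
  ultimately show False using assms(2) assms(3)[of j] by (simp add: degree_mult_eq)
qed

lemma weierstrass_remainder:
  fixes f :: "'k::field poly fps"
  assumes "fps_nth f 0 \<noteq> 0" "degree (fps_nth f 0) > 0"
  obtains P where "degree P < degree (fps_nth f 0)" "f dvd a - as_series P"
proof -
  let ?n = "degree (fps_nth f 0)"
  obtain Q R where QR: "a = f * Q + R" "\<And>j. fps_nth R j = 0 \<or> degree (fps_nth R j) < ?n"
    using weierstrass_division[OF assms(1)] by blast
  have "degree (fps_nth R j) \<le> ?n - 1" for j using QR(2)[of j] assms(2) by auto
  then obtain P where P: "as_series P = R" "degree P \<le> ?n - 1" by (rule as_series_surj)
  with QR(1) assms(2) show ?thesis by (intro that[of P]) auto
qed

lemma dvd_as_series_imp_zero: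
  fixes f :: "'k::field poly fps"
  assumes "f dvd as_series P" "fps_nth f 0 \<noteq> 0" "degree P < degree (fps_nth f 0)"
  shows "P = 0"
proof -
  have "fps_nth (as_series P) j = 0 \<or> degree (fps_nth (as_series P) j) < degree (fps_nth f 0)" for j
    using degree_as_series_nth[of P j] assms(3) by simp
  with assms(1,2) have "as_series P = 0" using dvd_small_degree_imp_zero by blast
  thus ?thesis by simp
qed

section \<open>Hensel's lemma\<close>

text \<open>
  Each new pair of coefficients solves a linear equation \<open>u v\<^sub>j + v u\<^sub>j = c\<close>, which is possible by the
  Bezout identity; reducing \<open>v\<^sub>j\<close> modulo \<open>v\<close> controls the degrees. Because of this control the
  factors of a polynomial over \<open>k[[y]]\<close> are again polynomials. The factor \<open>v\<close> may have smaller degree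
  than the polynomial even if \<open>u = 1\<close>: this splits off the roots that are not integral.
\<close>

lemma hensel_factorization:
  fixes F :: "'k::field poly fps"
  assumes F0: "fps_nth F 0 = u * v" and bez: "s * u + t * v = 1" and v: "v \<noteq> 0"
  obtains U V where "F = U * V" "fps_nth U 0 = u" "fps_nth V 0 = v"
    "\<And>j. degree (fps_nth V j) \<le> degree v"
    "\<And>N j. \<lbrakk>\<And>j. degree (fps_nth F j) \<le> N; u \<noteq> 0\<rbrakk> \<Longrightarrow> degree (fps_nth U j) \<le> N - degree v"
proof -
  define rest where "rest n c = fps_nth F n - (\<Sum>i\<in>{1..<n}. fst (c i) * snd (c (n - i)))"
    for n and c :: "nat \<Rightarrow> 'k poly \<times> 'k poly"
  define step where "step n c = (if n = 0 then (u, v) else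
      ((rest n c - u * (s * rest n c mod v)) div v, s * rest n c mod v))"
    for n and c :: "nat \<Rightarrow> 'k poly \<times> 'k poly"
  have rest_cong: "rest n c = rest n c'" if "\<And>j. j < n \<Longrightarrow> c j = c' j" for n c c'
    unfolding rest_def using that by (intro arg_cong2[where f = minus] sum.cong) auto
  have "step n c = step n c'" if "\<And>j. j < n \<Longrightarrow> c j = c' j" for n c c'
  proof -
    have "rest n c = rest n c'" using that by (rule rest_cong)
    thus ?thesis by (simp add: step_def)
  qed
  hence "\<exists>c. \<forall>n. c n = step n c" by (rule fps_recursion)
  then obtain c where c: "\<And>n. c n = step n c" by blast
  define U where "U = Abs_fps (\<lambda>n. fst (c n))"
  define V where "V = Abs_fps (\<lambda>n. snd (c n))"
  have c0: "c 0 = (u, v)" by (subst c) (simp add: step_def)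
  have sndc: "snd (c n) = s * rest n c mod v" if "n > 0" for n
    by (subst c) (use that in \<open>simp add: step_def\<close>)
  have fstc: "fst (c n) * v = rest n c - u * snd (c n)" if "n > 0" for n
  proof -
    have "rest n c - u * (s * rest n c mod v)
        = rest n c * (s * u + t * v) - u * (s * rest n c - v * (s * rest n c div v))"
      unfolding bez by (simp add: minus_mult_div_eq_mod)
    also have "\<dots> = v * (rest n c * t + u * (s * rest n c div v))"
      by (simp add: algebra_simps)
    finally have "v dvd rest n c - u * (s * rest n c mod v)" by simp
    moreover have "fst (c n) = (rest n c - u * (s * rest n c mod v)) div v"
      by (subst c) (use that in \<open>simp add: step_def\<close>)
    ultimately show ?thesis using that by (simp add: sndc)
  qed
  have "F = U * V"
  proof (rule fps_ext)
    fix n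
    show "fps_nth F n = fps_nth (U * V) n"
    proof (cases "n = 0")
      case True
      then show ?thesis by (simp add: U_def V_def c0 F0)
    next
      case False
      have "fps_nth (U * V) n = (\<Sum>i=0..n. fst (c i) * snd (c (n - i)))"
        by (simp add: U_def V_def fps_mult_nth)
      also have "{0..n} = insert 0 (insert n {1..<n})" using False by auto
      also have "(\<Sum>i\<in>\<dots>. fst (c i) * snd (c (n - i)))
          = u * snd (c n) + (fst (c n) * v + (\<Sum>i\<in>{1..<n}. fst (c i) * snd (c (n - i))))"
        using False by (simp add: c0)
      also have "\<dots> = fps_nth F n"
        using False by (simp add: fstc rest_def)
      finally show ?thesis ..
    qed
  qed
  moreover have "fps_nth U 0 = u" "fps_nth V 0 = v" by (simp_all add: U_def V_def c0)
  moreover have degV: "degree (fps_nth V j) \<le> degree v" for j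
  proof (cases "j = 0")
    case False
    thus ?thesis using degree_mod_less[OF v, of "s * rest j c"] by (auto simp: V_def sndc)
  qed (simp add: V_def c0)
  moreover have "degree (fps_nth U j) \<le> N - degree v"
    if N: "\<And>j. degree (fps_nth F j) \<le> N" and u: "u \<noteq> 0" for N j
  proof -
    have uv: "degree u + degree v \<le> N"
      using N[of 0] u v by (simp add: F0 degree_mult_eq)
    show ?thesis
    proof (induction j rule: less_induct)
      case (less j)
      show ?case
      proof (cases "j = 0")
        case True
        with uv show ?thesis by (simp add: U_def c0)
      next
        case False
        have "degree (fst (c i) * snd (c (j - i))) \<le> N" if "i \<in> {1..<j}" for i
        proof -
          have "degree (fst (c i) * snd (c (j - i))) \<le> degree (fst (c i)) + degree (snd (c (j - i)))"
            by (rule degree_mult_le)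
          also have "degree (fst (c i)) \<le> N - degree v" using less[of i] that by (simp add: U_def)
          also have "degree (snd (c (j - i))) \<le> degree v" using degV[of "j - i"] by (simp add: V_def)
          finally show ?thesis using uv by simp
        qed
        hence "degree (rest j c) \<le> N"
          unfolding rest_def using N by (intro degree_diff_le degree_sum_le) auto
        moreover have "degree (u * snd (c j)) \<le> N"
          using degree_mult_le[of u "snd (c j)"] degV[of j] uv by (simp add: V_def)
        ultimately have "degree (fst (c j) * v) \<le> N"
          using False by (simp add: fstc degree_diff_le)
        thus ?thesis using v by (cases "fst (c j) = 0") (auto simp: U_def degree_mult_eq)
      qed
    qed
  qed
  ultimately show ?thesis by (rule that)
qed

lemma hensel_factorization_poly:
  fixes P :: "'k::field fps poly"
  assumes "red P = u * v" "s * u + t * v = 1" "u \<noteq> 0" "v \<noteq> 0"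
  obtains U V where "P = U * V" "red U = u" "red V = v"
    "degree U \<le> degree P - degree v" "degree V \<le> degree v"
proof -
  have "fps_nth (as_series P) 0 = u * v" using assms(1) by (simp add: red_def)
  from hensel_factorization[OF this assms(2,4)] obtain A B where AB:
    "as_series P = A * B" "fps_nth A 0 = u" "fps_nth B 0 = v" "\<And>j. degree (fps_nth B j) \<le> degree v"
    "\<And>N j. \<lbrakk>\<And>j. degree (fps_nth (as_series P) j) \<le> N; u \<noteq> 0\<rbrakk> \<Longrightarrow> degree (fps_nth A j) \<le> N - degree v"
    by metis
  from as_series_surj[OF AB(4)] obtain V where V: "as_series V = B" "degree V \<le> degree v" by blast
  from AB(5)[OF degree_as_series_nth assms(3)]
  have "\<And>j. degree (fps_nth A j) \<le> degree P - degree v" .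
  from as_series_surj[OF this] obtain U where U: "as_series U = A" "degree U \<le> degree P - degree v" by blast
  have "as_series P = as_series (U * V)" by (simp add: AB(1) sr.hom_mult U V)
  hence "P = U * V" by simp
  with U V AB(2,3) show ?thesis by (intro that[of U V]) (auto simp: red_def)
qed

text \<open>
  If \<open>1 - t (X - c)\<close> is a multiple of \<open>q\<close>, then so is \<open>1 - (t (X - c))\<^sup>m\<close>. The first
  is arranged by dividing \<open>q\<close> by \<open>X - c\<close> with remainder \<open>q(c)\<close>.
\<close>

lemma bezout_root_power:
  fixes q :: "'k::field poly"
  assumes "poly q c \<noteq> 0"
  obtains s t where "s * q + t * [:- c, 1:] ^ m = 1"
proof -
  have "[:- c, 1:] dvd q - [:poly q c:]"
    by (simp add: poly_eq_0_iff_dvd[symmetric])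
  then obtain q' where q': "q - [:poly q c:] = [:- c, 1:] * q'" by (elim dvdE)
  define t where "t = smult (- inverse (poly q c)) q'"
  have "[:- c, 1:] * t = - smult (inverse (poly q c)) (q - [:poly q c:])"
    by (simp only: q' t_def mult_smult_right smult_minus_left mult_minus_right)
  also have "\<dots> = 1 - smult (inverse (poly q c)) q"
    using assms by (simp add: smult_diff_right one_pCons)
  finally have "1 - t * [:- c, 1:] = smult (inverse (poly q c)) q" by (simp add: mult.commute)
  hence "q dvd 1 - t * [:- c, 1:]" by (metis dvd_refl dvd_smult)
  also have "1 - t * [:- c, 1:] dvd 1 - (t * [:- c, 1:]) ^ m"
    by (metis one_diff_power_eq' dvd_triv_left)
  finally obtain s where "1 - (t * [:- c, 1:]) ^ m = q * s" by (elim dvdE)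
  hence "1 = q * s + (t * [:- c, 1:]) ^ m" by (simp only: diff_eq_eq)
  hence "s * q + t ^ m * [:- c, 1:] ^ m = 1" by (simp only: power_mult_distrib mult.commute[of s q])
  thus ?thesis by (rule that)
qed

section \<open>Roots of power series\<close>

text \<open>
  The first coefficient in which two series differ enters their \<open>q\<close>-th powers linearly. Hence the
  coefficients of a \<open>q\<close>-th root can be solved for one after the other.
\<close>

lemma fps_power_nth_perturb:
  fixes A B :: "'a::comm_ring_1 fps"
  assumes "\<And>j. j < n \<Longrightarrow> fps_nth A j = fps_nth B j" "n > 0"
  shows "fps_nth (A ^ q) n = fps_nth (B ^ q) n + of_nat q * fps_nth A 0 ^ (q - 1) * (fps_nth A n - fps_nth B n)"
proof -
  define D where "D = Abs_fps (\<lambda>j. fps_nth A (j + n) - fps_nth B (j + n))"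
  have AB: "A - B = fps_X ^ n * D"
    by (rule fps_ext) (use assms(1) in \<open>auto simp: D_def fps_X_power_mult_nth\<close>)
  have "A ^ q - B ^ q = fps_X ^ n * (D * (\<Sum>i<q. B ^ (q - Suc i) * A ^ i))"
    unfolding power_diff_sumr2 AB by (simp add: mult.assoc)
  hence "fps_nth (A ^ q - B ^ q) n = fps_nth D 0 * (\<Sum>i<q. fps_nth B 0 ^ (q - Suc i) * fps_nth A 0 ^ i)"
    by (simp add: fps_X_power_mult_nth fps_sum_nth fps_power_zeroth)
  also have "fps_nth B 0 = fps_nth A 0" using assms by simp
  also have "(\<Sum>i<q. fps_nth A 0 ^ (q - Suc i) * fps_nth A 0 ^ i) = (\<Sum>i<q. fps_nth A 0 ^ (q - 1))"
    by (rule sum.cong) (auto simp: power_add[symmetric])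
  finally show ?thesis by (simp add: D_def algebra_simps)
qed

lemma fps_root_exists:
  fixes F :: "'a::comm_ring_1 fps"
  assumes "fps_nth F 0 = a ^ q" "of_nat q * a ^ (q - 1) * w = 1"
  obtains G where "G ^ q = F" "fps_nth G 0 = a"
proof -
  define step where "step n c = (if n = 0 then a else
      w * (fps_nth F n - fps_nth (Abs_fps (\<lambda>j. if j < n then c j else 0) ^ q) n))" for n and c :: "nat \<Rightarrow> 'a"
  have "step n c = step n c'" if "\<And>j. j < n \<Longrightarrow> c j = c' j" for n c c'
  proof -
    have "(\<lambda>j. if j < n then c j else 0) = (\<lambda>j. if j < n then c' j else 0)" using that by auto
    thus ?thesis by (simp add: step_def)
  qed
  hence "\<exists>c. \<forall>n. c n = step n c" by (rule fps_recursion)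
  then obtain c where c: "\<And>n. c n = step n c" by blast
  define G where "G = Abs_fps c"
  have G0: "fps_nth G 0 = a" using c[of 0] by (simp add: G_def step_def)
  have "G ^ q = F"
  proof (rule fps_ext)
    fix n
    show "fps_nth (G ^ q) n = fps_nth F n"
    proof (cases "n = 0")
      case True
      then show ?thesis by (simp add: G0 assms(1) fps_power_zeroth)
    next
      case False
      define T where "T = Abs_fps (\<lambda>j. if j < n then c j else 0)"
      have "fps_nth (G ^ q) n = fps_nth (T ^ q) n + of_nat q * a ^ (q - 1) * c n"
        by (subst fps_power_nth_perturb[where B = T and n = n])
           (use False G0 in \<open>auto simp: G_def T_def\<close>)
      also have "c n = w * (fps_nth F n - fps_nth (T ^ q) n)"
        by (subst c) (use False in \<open>simp add: step_def T_def\<close>)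
      also have "of_nat q * a ^ (q - 1) * (w * (fps_nth F n - fps_nth (T ^ q) n))
          = (of_nat q * a ^ (q - 1) * w) * (fps_nth F n - fps_nth (T ^ q) n)"
        by (simp add: mult.assoc)
      also have "\<dots> = fps_nth F n - fps_nth (T ^ q) n" by (simp only: assms(2) mult_1)
      finally show ?thesis by simp
    qed
  qed
  thus ?thesis using G0 by (rule that)
qed

text \<open>
  The polynomial \<open>C\<close> is a truncation of the power series \<open>(c + X)\<^bsup>-1/q\<^esup>\<close>. A polynomial can be
  evaluated at any element, without a notion of convergence.
\<close>

lemma truncated_root:
  fixes c :: "'k::alg_closed_field"
  assumes "c \<noteq> 0" "of_nat q \<noteq> (0 :: 'k)"
  obtains C R :: "'k poly" where "C ^ q * [:c, 1:] = 1 + monom 1 M * R"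
proof -
  have "q > 0" using assms(2) by (cases q) auto
  then obtain a where a: "a ^ q = inverse c" using nth_root_exists by blast
  with assms(1) \<open>q > 0\<close> have "a \<noteq> 0" by (auto simp: power_0_left)
  obtain G where G: "G ^ q = inverse (fps_const c + fps_X)"
  proof (rule fps_root_exists[of "inverse (fps_const c + fps_X)" a q "inverse (of_nat q * a ^ (q - 1))"])
    show "of_nat q * a ^ (q - 1) * inverse (of_nat q * a ^ (q - 1)) = 1"
      by (rule right_inverse) (use \<open>a \<noteq> 0\<close> assms(2) in simp)
  qed (use a in auto)
  define C where "C = (\<Sum>i<M. monom (fps_nth G i) i)"
  have C: "coeff C i = fps_nth G i" if "i < M" for i using that by (simp add: C_def coeff_sum)
  have Cq: "coeff (C ^ q) i = fps_nth (G ^ q) i" if "i < M" for i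
  proof (cases "i = 0")
    case True
    then show ?thesis using C[of 0] that by (simp add: coeff_0_power fps_power_zeroth)
  next
    case False
    with fps_power_nth_perturb[of i "fps_of_poly C" G q] that C
    show ?thesis by (simp flip: fps_of_poly_power)
  qed
  have "monom 1 M dvd C ^ q * [:c, 1:] - 1"
    unfolding monom_1_dvd_iff'
  proof (intro allI impI)
    fix i assume i: "i < M"
    have "coeff (C ^ q * [:c, 1:]) i = fps_nth (fps_of_poly (C ^ q) * fps_of_poly [:c, 1:]) i"
      by (simp flip: fps_of_poly_mult)
    also have "fps_of_poly [:c, 1:] = fps_const c + fps_X"
      by (simp add: fps_of_poly_pCons)
    also have "fps_nth (fps_of_poly (C ^ q) * (fps_const c + fps_X)) i = fps_nth (G ^ q * (fps_const c + fps_X)) i"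
      using i by (auto simp: fps_mult_nth Cq intro!: sum.cong)
    also have "G ^ q * (fps_const c + fps_X) = 1"
      using assms(1) by (simp add: G inverse_mult_eq_1)
    finally show "coeff (C ^ q * [:c, 1:] - 1) i = 0" by simp
  qed
  then obtain R where "C ^ q * [:c, 1:] - 1 = monom 1 M * R" by (elim dvdE)
  hence "C ^ q * [:c, 1:] = 1 + monom 1 M * R" by (simp add: algebra_simps)
  thus ?thesis by (rule that)
qed

section \<open>Codimension of ideals\<close>

definition ideal_set :: "'a::comm_ring_1 set \<Rightarrow> bool" where
  "ideal_set V \<longleftrightarrow> 0 \<in> V \<and> (\<forall>a\<in>V. \<forall>b\<in>V. a + b \<in> V) \<and> (\<forall>a\<in>V. \<forall>r. r * a \<in> V)"

lemma ideal_setD: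
  assumes "ideal_set V"
  shows "0 \<in> V" "a \<in> V \<Longrightarrow> b \<in> V \<Longrightarrow> a + b \<in> V" "a \<in> V \<Longrightarrow> r * a \<in> V"
    "a \<in> V \<Longrightarrow> b \<in> V \<Longrightarrow> a - b \<in> V"
proof -
  show "0 \<in> V" "a \<in> V \<Longrightarrow> b \<in> V \<Longrightarrow> a + b \<in> V" "a \<in> V \<Longrightarrow> r * a \<in> V" for a b r
    using assms by (auto simp: ideal_set_def)
  from this(2)[of a "-b"] this(3)[of b "-1"] show "a \<in> V \<Longrightarrow> b \<in> V \<Longrightarrow> a - b \<in> V" by simp
qed

lemma ideal_set_sum: "ideal_set V \<Longrightarrow> (\<And>i. i \<in> I \<Longrightarrow> F i \<in> V) \<Longrightarrow> sum F I \<in> V"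
  by (induction I rule: infinite_finite_induct) (auto intro: ideal_setD)

definition ideal2 :: "'a::comm_ring_1 \<Rightarrow> 'a \<Rightarrow> 'a set" where
  "ideal2 f g = {f * u + g * v | u v. True}"

lemma ideal2_iff: "a \<in> ideal2 f g \<longleftrightarrow> (\<exists>v. f dvd a - g * v)"
proof
  assume "a \<in> ideal2 f g"
  then obtain u v where "a = f * u + g * v" by (auto simp: ideal2_def)
  hence "a - g * v = f * u" by simp
  thus "\<exists>v. f dvd a - g * v" by (metis dvd_triv_left)
next
  assume "\<exists>v. f dvd a - g * v"
  then obtain u v where "a - g * v = f * u" by (auto elim: dvdE)
  hence "a = f * u + g * v" by (simp add: algebra_simps)
  thus "a \<in> ideal2 f g" by (auto simp: ideal2_def)
qed

lemma ideal_set_ideal2: "ideal_set (ideal2 f g)"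
  unfolding ideal_set_def ideal2_iff
proof (intro conjI ballI allI)
  show "\<exists>v. f dvd 0 - g * v" by (rule exI[of _ 0]) simp
  fix a assume "a \<in> ideal2 f g"
  then obtain v where v: "f dvd a - g * v" by (auto simp: ideal2_iff)
  show "\<exists>v. f dvd r * a - g * v" for r
    using dvd_mult[OF v, of r] by (intro exI[of _ "r * v"]) (simp add: algebra_simps)
  fix b assume "b \<in> ideal2 f g"
  then obtain w where w: "f dvd b - g * w" by (auto simp: ideal2_iff)
  show "\<exists>v. f dvd a + b - g * v"
    using dvd_add[OF v w] by (intro exI[of _ "v + w"]) (simp add: algebra_simps)
qed

lemma ideal2_commute: "ideal2 f g = ideal2 g f"
  by (auto simp: ideal2_def) (metis add.commute)+

lemma ideal2_cong:
  assumes "f dvd g - h"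
  shows "ideal2 f g = ideal2 f h"
proof -
  have "a \<in> ideal2 f g' \<Longrightarrow> f dvd g' - h' \<Longrightarrow> a \<in> ideal2 f h'" for a g' h'
  proof -
    assume "a \<in> ideal2 f g'" "f dvd g' - h'"
    then obtain v where "f dvd a - g' * v" by (auto simp: ideal2_iff)
    with \<open>f dvd g' - h'\<close> have "f dvd (a - g' * v) + (g' - h') * v"
      by (intro dvd_add dvd_mult2)
    thus ?thesis by (auto simp: ideal2_iff algebra_simps intro!: exI[of _ v])
  qed
  moreover have "f dvd h - g" using assms by (metis dvd_minus_iff minus_diff_eq)
  ultimately show ?thesis using assms by blast
qed

lemma ideal2_mult_subset: "ideal2 f (g * h) \<subseteq> ideal2 f g"
  by (auto simp: ideal2_def) (metis mult.assoc)

locale field_algebra = unital_hom s for s :: "'k::field \<Rightarrow> 'a::comm_ring_1"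
begin

definition comb :: "(nat \<Rightarrow> 'a) \<Rightarrow> nat \<Rightarrow> (nat \<Rightarrow> 'k) \<Rightarrow> 'a" where
  "comb b N c = (\<Sum>i<N. s (c i) * b i)"

definition spans_mod :: "'a set \<Rightarrow> (nat \<Rightarrow> 'a) \<Rightarrow> nat \<Rightarrow> bool" where
  "spans_mod V b N \<longleftrightarrow> (\<forall>a. \<exists>c. a - comb b N c \<in> V)"

definition indep_mod :: "'a set \<Rightarrow> (nat \<Rightarrow> 'a) \<Rightarrow> nat \<Rightarrow> bool" where
  "indep_mod V b N \<longleftrightarrow> (\<forall>c. comb b N c \<in> V \<longrightarrow> (\<forall>i<N. c i = 0))"

definition has_codim :: "'a set \<Rightarrow> nat \<Rightarrow> bool" where
  "has_codim V N \<longleftrightarrow> (\<exists>b. spans_mod V b N \<and> indep_mod V b N)"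

definition codim :: "'a set \<Rightarrow> nat" where
  "codim V = (THE N. has_codim V N)"

definition fin_codim :: "'a set \<Rightarrow> bool" where
  "fin_codim V \<longleftrightarrow> (\<exists>N. has_codim V N)"

text \<open>
  The Steinitz bound in the quotient by \<open>V\<close>: more than \<open>N\<close> elements have linearly dependent
  coordinates with respect to a spanning family of length \<open>N\<close>.
\<close>

lemma indep_le_spans:
  assumes V: "ideal_set V" and sp: "spans_mod V b N" and ind: "indep_mod V b' N'"
  shows "N' \<le> N"
proof (rule ccontr)
  assume "\<not> N' \<le> N"
  hence less: "N < N'" by simp
  from sp have "\<exists>c. b' j - comb b N c \<in> V" for j by (auto simp: spans_mod_def)
  then obtain m where m: "\<And>j. b' j - comb b N (m j) \<in> V" by metis
  from exists_linear_relation[OF less, of m] obtain u where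
    u: "\<exists>j<N'. u j \<noteq> 0" "\<forall>i<N. (\<Sum>j<N'. u j * m j i) = 0" by blast
  have "(\<Sum>j<N'. s (u j) * comb b N (m j)) = (\<Sum>j<N'. \<Sum>i<N. s (u j * m j i) * b i)"
    by (simp add: comb_def sum_distrib_left hom_mult mult.assoc)
  also have "\<dots> = (\<Sum>i<N. s (\<Sum>j<N'. u j * m j i) * b i)"
    by (subst sum.swap) (simp add: hom_sum sum_distrib_right)
  also have "\<dots> = 0" using u(2) by (simp add: hom_zero)
  finally have "comb b' N' u = (\<Sum>j<N'. s (u j) * (b' j - comb b N (m j)))"
    by (simp add: comb_def algebra_simps sum_subtractf)
  also have "\<dots> \<in> V" using V m by (intro ideal_set_sum ideal_setD(3)) auto
  finally show False using ind u(1) by (auto simp: indep_mod_def)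
qed

lemma has_codim_unique: "ideal_set V \<Longrightarrow> has_codim V N \<Longrightarrow> has_codim V N' \<Longrightarrow> N = N'"
  unfolding has_codim_def by (meson indep_le_spans le_antisym)

lemma codim_eq: "ideal_set V \<Longrightarrow> has_codim V N \<Longrightarrow> codim V = N"
  unfolding codim_def using has_codim_unique by blast

lemma fin_codimD: "ideal_set V \<Longrightarrow> fin_codim V \<Longrightarrow> has_codim V (codim V)"
  unfolding fin_codim_def using codim_eq by auto

text \<open>
  A spanning family modulo \<open>V\<close> also spans modulo \<open>W\<close>, so families independent modulo \<open>W\<close> have
  bounded length, and one of maximal length is a basis.
\<close>

lemma fin_codim_mono:
  assumes V: "ideal_set V" and W: "ideal_set W" and sub: "V \<subseteq> W" and fin: "fin_codim V"
  shows "fin_codim W"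
proof -
  from fin obtain N b where sp: "spans_mod V b N" by (auto simp: fin_codim_def has_codim_def)
  hence spW: "spans_mod W b N" using sub unfolding spans_mod_def by blast
  define P where "P M \<longleftrightarrow> (\<exists>b. indep_mod W b M)" for M
  have "P 0" by (simp add: P_def indep_mod_def)
  moreover have bound: "M \<le> N" if "P M" for M
    using that indep_le_spans[OF W spW] by (auto simp: P_def)
  ultimately obtain M where M: "P M" "\<And>M'. P M' \<Longrightarrow> M' \<le> M"
    using GreatestI_nat[of P 0 N] Greatest_le_nat[of P _ N] by blast
  from M(1) obtain d where d: "indep_mod W d M" by (auto simp: P_def)
  have "spans_mod W d M"
    unfolding spans_mod_def
  proof
    fix a
    define d' where "d' = d(M := a)"
    have comb': "comb d' (Suc M) c = comb d M c + s (c M) * a" for c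
      by (simp add: comb_def d'_def)
    from M(2)[of "Suc M"] have "\<not> indep_mod W d' (Suc M)" by (auto simp: P_def)
    then obtain c i where c: "comb d M c + s (c M) * a \<in> W" "i < Suc M" "c i \<noteq> 0"
      by (auto simp: indep_mod_def comb')
    have "c M \<noteq> 0"
    proof
      assume "c M = 0"
      hence "comb d M c \<in> W" using c(1) by (simp add: hom_zero)
      hence "\<forall>i<M. c i = 0" using d by (auto simp: indep_mod_def)
      with c \<open>c M = 0\<close> show False by (auto simp: less_Suc_eq)
    qed
    have "s (inverse (c M)) * (comb d M c + s (c M) * a) \<in> W"
      using c(1) W by (intro ideal_setD(3))
    also have "s (inverse (c M)) * (comb d M c + s (c M) * a)
        = a - comb d M (\<lambda>i. - inverse (c M) * c i)"
      using \<open>c M \<noteq> 0\<close>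
      by (simp add: comb_def algebra_simps sum_distrib_left hom_simps sum_negf
            flip: hom_mult mult.assoc)
    finally show "\<exists>c. a - comb d M c \<in> W" by blast
  qed
  with d show ?thesis by (auto simp: fin_codim_def has_codim_def)
qed

text \<open>
  Multiplication by \<open>g\<close> is injective modulo the prime \<open>f\<close>. Hence a basis modulo \<open>(f,g)\<close> together with
  \<open>g\<close> times a basis modulo \<open>(f,h)\<close> is a basis modulo \<open>(f,gh)\<close>.
\<close>

lemma has_codim_mult:
  assumes prime: "\<And>a b. f dvd a * b \<Longrightarrow> f dvd a \<or> f dvd b"
    and g: "\<not> f dvd g"
    and N: "has_codim (ideal2 f g) N" and M: "has_codim (ideal2 f h) M"
  shows "has_codim (ideal2 f (g * h)) (N + M)"
proof -
  from N obtain b where b: "spans_mod (ideal2 f g) b N" "indep_mod (ideal2 f g) b N"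
    by (auto simp: has_codim_def)
  from M obtain d where d: "spans_mod (ideal2 f h) d M" "indep_mod (ideal2 f h) d M"
    by (auto simp: has_codim_def)
  define e where "e i = (if i < N then b i else g * d (i - N))" for i
  have comb_e: "comb e (N + M) c = comb b N c + g * comb d M (\<lambda>j. c (N + j))" for c
  proof -
    have "sum F {..<N + M} = sum F {..<N} + (\<Sum>j<M. F (N + j))" for F :: "nat \<Rightarrow> 'a"
      by (induction M) (simp_all add: add.assoc)
    thus ?thesis by (simp add: comb_def e_def sum_distrib_left mult.left_commute)
  qed
  have "spans_mod (ideal2 f (g * h)) e (N + M)"
    unfolding spans_mod_def
  proof
    fix a
    from b(1) obtain c v where c: "f dvd a - comb b N c - g * v"
      unfolding spans_mod_def ideal2_iff by blast
    from d(1) obtain c' w where c': "f dvd v - comb d M c' - h * w"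
      unfolding spans_mod_def ideal2_iff by blast
    define C where "C i = (if i < N then c i else c' (i - N))" for i
    have "comb e (N + M) C = comb b N c + g * comb d M c'"
      unfolding comb_e by (simp add: comb_def C_def)
    moreover have "f dvd (a - comb b N c - g * v) + g * (v - comb d M c' - h * w)"
      using c c' by (intro dvd_add dvd_mult)
    ultimately have "f dvd a - comb e (N + M) C - g * h * w"
      by (simp add: algebra_simps)
    thus "\<exists>c. a - comb e (N + M) c \<in> ideal2 f (g * h)" by (auto simp: ideal2_iff)
  qed
  moreover have "indep_mod (ideal2 f (g * h)) e (N + M)"
    unfolding indep_mod_def
  proof (intro allI impI)
    fix c i assume "comb e (N + M) c \<in> ideal2 f (g * h)" and i: "i < N + M"
    then obtain w where w: "f dvd comb b N c + g * comb d M (\<lambda>j. c (N + j)) - g * h * w"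
      by (auto simp: ideal2_iff comb_e)
    hence "f dvd comb b N c - g * (h * w - comb d M (\<lambda>j. c (N + j)))"
      by (simp add: algebra_simps)
    hence "comb b N c \<in> ideal2 f g" unfolding ideal2_iff by blast
    hence c0: "c i = 0" if "i < N" for i using b(2) that by (auto simp: indep_mod_def)
    hence "comb b N c = 0" by (simp add: comb_def hom_zero)
    with w have "f dvd g * (comb d M (\<lambda>j. c (N + j)) - h * w)"
      by (simp add: algebra_simps)
    with prime g have "f dvd comb d M (\<lambda>j. c (N + j)) - h * w" by blast
    hence "comb d M (\<lambda>j. c (N + j)) \<in> ideal2 f h" by (auto simp: ideal2_iff)
    hence "c (N + j) = 0" if "j < M" for j using d(2) that by (auto simp: indep_mod_def)
    from this[of "i - N"] c0 i show "c i = 0" by (cases "i < N") auto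
  qed
  ultimately show ?thesis by (auto simp: has_codim_def)
qed

lemma has_codim_unit: "g dvd 1 \<Longrightarrow> has_codim (ideal2 f g) 0"
proof -
  assume "g dvd 1"
  then obtain w where "1 = g * w" by (elim dvdE)
  hence "a - g * (w * a) = 0" for a by (simp flip: mult.assoc)
  hence "a \<in> ideal2 f g" for a unfolding ideal2_iff by (metis dvd_0_right)
  thus ?thesis by (auto simp: has_codim_def spans_mod_def indep_mod_def)
qed

lemma codim_mult:
  assumes "\<And>a b. f dvd a * b \<Longrightarrow> f dvd a \<or> f dvd b" "\<not> f dvd g"
    and "fin_codim (ideal2 f g)" "fin_codim (ideal2 f h)"
  shows "fin_codim (ideal2 f (g * h))"
    "codim (ideal2 f (g * h)) = codim (ideal2 f g) + codim (ideal2 f h)"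
proof -
  note fin = fin_codimD[OF ideal_set_ideal2 assms(3)] fin_codimD[OF ideal_set_ideal2 assms(4)]
  from has_codim_mult[OF assms(1,2) fin]
  have *: "has_codim (ideal2 f (g * h)) (codim (ideal2 f g) + codim (ideal2 f h))" .
  from codim_eq[OF ideal_set_ideal2 this] *
  show "fin_codim (ideal2 f (g * h))"
    "codim (ideal2 f (g * h)) = codim (ideal2 f g) + codim (ideal2 f h)"
    by (auto simp: fin_codim_def)
qed

lemma codim_power:
  assumes "\<And>a b. f dvd a * b \<Longrightarrow> f dvd a \<or> f dvd b" "\<not> f dvd g" "fin_codim (ideal2 f g)"
  shows "fin_codim (ideal2 f (g ^ m)) \<and> codim (ideal2 f (g ^ m)) = m * codim (ideal2 f g)"
proof (induction m)
  case 0
  have "has_codim (ideal2 f 1) 0" by (rule has_codim_unit) simp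
  then show ?case using codim_eq[OF ideal_set_ideal2] by (auto simp: fin_codim_def)
next
  case (Suc m)
  then show ?case using codim_mult[OF assms, of "g ^ m"] by simp
qed

end

section \<open>The field of a branch and its valuation\<close>

global_interpretation ka: field_algebra "scalar :: 'k::field \<Rightarrow> 'k poly fps"
  by unfold_locales (simp_all add: xc.hom_simps flip: fps_const_add fps_const_mult)

text \<open>
  A model of the field of fractions of \<open>k[x][[y]]/(f)\<close>: the image of \<open>\<phi>\<close> is a copy of the quotient
  inside a field. The prefixes \<open>io\<close> and \<open>kk\<close> below refer to evaluation of polynomials with
  coefficients in \<open>k[[y]]\<close> and in \<open>k\<close>, respectively.
\<close>

locale branch = unital_hom \<phi>
  for \<phi> :: "'k::alg_closed_field poly fps \<Rightarrow> 'l::field" +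
  fixes f :: "'k poly fps"
  assumes f0: "fps_nth f 0 \<noteq> 0"
    and kernel: "\<phi> a = 0 \<longleftrightarrow> f dvd a"
begin

definition n :: nat where "n = degree (fps_nth f 0)"
definition Y :: 'l where "Y = \<phi> fps_X"
definition \<xi> :: 'l where "\<xi> = \<phi> (fps_const [:0, 1:])"

sublocale io: unital_hom "\<lambda>w. \<phi> (x_const w)"
  by unfold_locales (simp_all add: xc.hom_simps hom_simps)

abbreviation \<iota> :: "'k fps \<Rightarrow> 'l" where "\<iota> w \<equiv> \<phi> (x_const w)"

sublocale kk: unital_hom "\<lambda>c. \<phi> (scalar c)"
  by unfold_locales (simp_all add: ka.hom_add ka.hom_mult xc.hom_one hom_simps)

abbreviation \<kappa> :: "'k \<Rightarrow> 'l" where "\<kappa> c \<equiv> \<phi> (scalar c)"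

lemma phi_eq_iff: "\<phi> a = \<phi> b \<longleftrightarrow> f dvd a - b"
  by (simp add: kernel[symmetric] hom_diff)

lemma f_prime: "f dvd a * b \<Longrightarrow> f dvd a \<or> f dvd b"
  by (simp add: kernel[symmetric] hom_mult)

lemma phi_xc_ev: "\<phi> (xc.ev a P) = io.ev (\<phi> a) P"
  by (induction P) (simp_all add: xc.ev_0 io.ev_0 xc.ev_pCons io.ev_pCons hom_simps)

lemma phi_as_series: "\<phi> (as_series P) = io.ev \<xi> P"
  by (simp add: as_series_def phi_xc_ev \<xi>_def)

lemma n_pos: "n > 0"
proof (rule ccontr)
  assume "\<not> n > 0"
  obtain Q R where QR: "1 = f * Q + R" "\<And>j. fps_nth R j = 0 \<or> degree (fps_nth R j) < degree (fps_nth f 0)"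
    using weierstrass_division[OF f0] by blast
  with \<open>\<not> n > 0\<close> have "R = 0" by (intro fps_ext) (auto simp: n_def)
  with QR(1) have "f dvd 1" by (metis add.right_neutral dvd_triv_left)
  hence "\<phi> 1 = 0" by (simp add: kernel)
  thus False by (simp add: hom_one)
qed

text \<open>
  With \<open>remainder_exists\<close>, this says that \<open>1, x, ..., x\<^bsup>n-1\<^esup>\<close> form a basis of the quotient over
  \<open>k[[y]]\<close>.
\<close>

lemma small_degree_inj:
  assumes "degree P < n" "io.ev \<xi> P = 0"
  shows "P = 0"
  using dvd_as_series_imp_zero[OF _ f0] assms by (simp add: n_def kernel flip: phi_as_series)

lemma remainder_exists: "\<exists>P. degree P < n \<and> \<phi> a = io.ev \<xi> P"
proof -
  obtain P where "degree P < n" "f dvd a - as_series P"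
    using weierstrass_remainder[OF f0] n_pos unfolding n_def by blast
  thus ?thesis by (auto simp: phi_eq_iff simp flip: phi_as_series)
qed

lemma iota_eq_0_iff [simp]: "\<iota> w = 0 \<longleftrightarrow> w = 0"
proof
  assume "\<iota> w = 0"
  with n_pos have "[:w:] = 0" by (intro small_degree_inj) (simp_all add: io.ev_pCons io.ev_0)
  thus "w = 0" by simp
qed (simp add: io.hom_zero)

lemma Y_iota: "Y = \<iota> fps_X"
  by (simp add: Y_def)

lemma Y_nz [simp]: "Y \<noteq> 0"
  by (simp add: Y_iota del: x_const_X)

lemma X_not_dvd: "\<not> f dvd fps_X ^ r"
  by (simp flip: kernel Y_def add: hom_power)

text \<open>
  The \<open>n + 1\<close> powers \<open>1, a, ..., a\<^sup>n\<close> are linearly dependent, because the quotient has rank \<open>n\<close>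
  over \<open>k[[y]]\<close>.
\<close>

lemma algebraic: "\<exists>P. P \<noteq> 0 \<and> io.ev (\<phi> a) P = 0"
proof -
  have "\<exists>m. \<phi> (a ^ i) = (\<Sum>j<n. \<iota> (m j) * \<xi> ^ j)" for i
  proof -
    obtain P where "degree P < n" "\<phi> (a ^ i) = io.ev \<xi> P" using remainder_exists by blast
    thus ?thesis by (auto simp: io.ev_as_sum)
  qed
  then obtain m where m: "\<And>i. \<phi> (a ^ i) = (\<Sum>j<n. \<iota> (m i j) * \<xi> ^ j)" by metis
  obtain u where u: "\<exists>i<Suc n. u i \<noteq> 0" "\<forall>j<n. (\<Sum>i<Suc n. u i * m i j) = 0"
    using exists_linear_relation[of n "Suc n" m] by auto
  define P where "P = (\<Sum>i<Suc n. monom (u i) i)"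
  have "coeff P i = u i" if "i < Suc n" for i
    using that by (simp add: P_def coeff_sum del: sum.lessThan_Suc)
  with u(1) have "P \<noteq> 0" by (metis coeff_0)
  have "io.ev (\<phi> a) P = (\<Sum>i<Suc n. \<iota> (u i) * \<phi> (a ^ i))"
    by (simp add: P_def io.ev_sum io.ev_monom hom_power del: sum.lessThan_Suc)
  also have "\<dots> = (\<Sum>i<Suc n. \<Sum>j<n. \<iota> (u i * m i j) * \<xi> ^ j)"
    by (simp add: m sum_distrib_left io.hom_mult mult.assoc del: sum.lessThan_Suc)
  also have "\<dots> = (\<Sum>j<n. \<iota> (\<Sum>i<Suc n. u i * m i j) * \<xi> ^ j)"
    by (subst sum.swap) (simp add: io.hom_sum sum_distrib_right del: sum.lessThan_Suc)
  also have "\<dots> = 0" using u(2) by (simp add: io.hom_zero del: sum.lessThan_Suc)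
  finally show ?thesis using \<open>P \<noteq> 0\<close> by blast
qed

text \<open>
  The constant term of a relation of least degree for \<open>a\<close> is not zero and is a multiple of \<open>a\<close> modulo
  \<open>f\<close>; up to a unit it is a power of \<open>y\<close>. It follows that the ideals \<open>(f,a)\<close> have finite
  codimension, and that powers of \<open>y\<close> suffice as denominators in the field of fractions.
\<close>

lemma power_X_multiple:
  assumes "\<not> f dvd a"
  shows "\<exists>r b. f dvd fps_X ^ r - a * b"
proof -
  define Q where "Q P \<longleftrightarrow> P \<noteq> 0 \<and> io.ev (\<phi> a) P = 0" for P
  obtain P where P: "Q P" and min: "\<And>P'. Q P' \<Longrightarrow> degree P \<le> degree P'"
    using algebraic[of a] ex_has_least_nat[of Q _ degree] unfolding Q_def by metis
  obtain p P' where pP: "P = pCons p P'" by (cases P)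
  have "p \<noteq> 0"
  proof
    assume "p = 0"
    with P pP assms have "Q P'" by (auto simp: Q_def io.ev_pCons kernel io.hom_zero)
    from min[OF this] P \<open>p = 0\<close> show False by (auto simp: Q_def pP split: if_splits)
  qed
  define r where "r = subdegree p"
  define w where "w = fps_shift r p"
  have "p = w * fps_X ^ r" by (simp add: w_def r_def subdegree_decompose[symmetric])
  moreover have "fps_nth w 0 \<noteq> 0" using \<open>p \<noteq> 0\<close> by (simp add: w_def r_def)
  hence "w * inverse w = 1" by (simp add: inverse_mult_eq_1')
  ultimately have p: "p * inverse w = fps_X ^ r" by (simp add: mult_ac)
  have "\<phi> (x_const p + a * xc.ev a P') = 0"
    using P by (simp add: Q_def pP io.ev_pCons hom_simps phi_xc_ev)
  hence "f dvd (x_const p + a * xc.ev a P') * x_const (inverse w)" by (simp add: kernel)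
  also have "\<dots> = fps_X ^ r - a * (- xc.ev a P' * x_const (inverse w))"
    by (simp add: algebra_simps flip: xc.hom_mult) (simp add: p mult.commute xc.hom_power)
  finally show ?thesis by blast
qed

abbreviation len :: "'k poly fps \<Rightarrow> nat" where
  "len a \<equiv> ka.codim (ideal2 f a)"

lemma has_codim_X: "ka.has_codim (ideal2 f fps_X) n"
  unfolding ka.has_codim_def
proof (intro exI conjI)
  \<comment> \<open>The powers of \<open>x\<close> below \<open>n\<close> are a basis modulo \<open>(f,y)\<close>, by division by \<open>f(x,0)\<close> in \<open>k[x]\<close>.\<close>
  define b where "b i = fps_const (monom (1::'k) i)" for i
  have comb0: "fps_nth (ka.comb b N c) 0 = (\<Sum>i<N. monom (c i) i)" for N c
    by (simp add: ka.comb_def b_def fps_sum_nth smult_monom)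
  show "ka.spans_mod (ideal2 f fps_X) b n"
    unfolding ka.spans_mod_def ideal2_iff
  proof
    fix a :: "'k poly fps"
    define r where "r = fps_nth a 0 mod fps_nth f 0"
    define q where "q = fps_nth a 0 div fps_nth f 0"
    have "degree r < n" using degree_mod_less[OF f0, of "fps_nth a 0"] n_pos by (auto simp: r_def n_def)
    hence r: "r = (\<Sum>i<n. monom (coeff r i) i)"
      by (intro poly_eqI) (auto simp: coeff_sum coeff_eq_0)
    hence "fps_nth (a - ka.comb b n (coeff r) - f * fps_const q) 0 = 0"
      by (simp add: comb0 flip: r) (simp add: r_def q_def minus_mod_eq_mult_div)
    from fps_X_times_shift[OF this]
    obtain v where v: "a - ka.comb b n (coeff r) - f * fps_const q = fps_X * v" by metis
    hence "f dvd a - ka.comb b n (coeff r) - fps_X * v" by (simp add: algebra_simps)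
    thus "\<exists>c v. f dvd a - ka.comb b n c - fps_X * v" by blast
  qed
  show "ka.indep_mod (ideal2 f fps_X) b n"
    unfolding ka.indep_mod_def ideal2_iff
  proof (intro allI impI)
    fix c i assume "\<exists>v. f dvd ka.comb b n c - fps_X * v" and i: "i < n"
    then obtain v u where "ka.comb b n c - fps_X * v = f * u" by (auto elim: dvdE)
    hence "fps_nth (ka.comb b n c - fps_X * v) 0 = fps_nth f 0 * fps_nth u 0" by simp
    hence eq: "(\<Sum>i<n. monom (c i) i) = fps_nth f 0 * fps_nth u 0" by (simp add: comb0)
    have "degree (\<Sum>i<n. monom (c i) i) < n"
      using n_pos by (intro degree_sum_less) (auto intro: le_less_trans[OF degree_monom_le])
    with eq f0 have "(\<Sum>i<n. monom (c i) i) = 0"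
      by (cases "fps_nth u 0 = 0") (auto simp: degree_mult_eq n_def)
    hence "coeff (\<Sum>i<n. monom (c i) i) i = 0" by simp
    with i show "c i = 0" by (simp add: coeff_sum)
  qed
qed

lemma len_X: "ka.fin_codim (ideal2 f fps_X)" "len fps_X = n"
  using has_codim_X ka.codim_eq[OF ideal_set_ideal2] by (auto simp: ka.fin_codim_def)

lemma len_X_power: "ka.fin_codim (ideal2 f (fps_X ^ r))" "len (fps_X ^ r) = r * n"
  using ka.codim_power[OF f_prime _ len_X(1), of r] X_not_dvd[of 1] len_X(2) by auto

lemma fin_codim: "\<not> f dvd a \<Longrightarrow> ka.fin_codim (ideal2 f a)"
proof -
  assume "\<not> f dvd a"
  then obtain r b where "f dvd fps_X ^ r - a * b" using power_X_multiple by blast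
  hence "ideal2 f (fps_X ^ r) \<subseteq> ideal2 f a"
    using ideal2_mult_subset by (simp add: ideal2_cong)
  thus ?thesis by (rule ka.fin_codim_mono[OF ideal_set_ideal2 ideal_set_ideal2 _ len_X_power(1)])
qed

lemma len_mult: "\<not> f dvd a \<Longrightarrow> \<not> f dvd b \<Longrightarrow> len (a * b) = len a + len b"
  by (rule ka.codim_mult(2)) (use f_prime fin_codim in blast)+

lemma len_cong: "\<phi> a = \<phi> b \<Longrightarrow> len a = len b"
  by (simp add: phi_eq_iff ideal2_cong)

text \<open>The field of fractions; see \<open>power_X_multiple\<close> for the choice of denominators.\<close>

definition K :: "'l set" where "K = {z. \<exists>a r. z * Y ^ r = \<phi> a}"

lemma K_I: "z * Y ^ r = \<phi> a \<Longrightarrow> z \<in> K"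
  by (auto simp: K_def)

lemma K_E: "z \<in> K \<Longrightarrow> (\<And>a r. z * Y ^ r = \<phi> a \<Longrightarrow> P) \<Longrightarrow> P"
  by (auto simp: K_def)

lemma K_phi [simp]: "\<phi> a \<in> K"
  by (rule K_I[of _ 0]) simp

lemma K_Y [simp]: "Y \<in> K"
  by (simp add: Y_def)

lemma K_0 [simp]: "0 \<in> K" and K_1 [simp]: "1 \<in> K"
  using K_phi[of 0] K_phi[of 1] by (simp_all only: hom_zero hom_one)

lemma K_mult [intro]: "z \<in> K \<Longrightarrow> w \<in> K \<Longrightarrow> z * w \<in> K"
proof (elim K_E)
  fix a b r s assume zw: "z * Y ^ r = \<phi> a" "w * Y ^ s = \<phi> b"
  hence "(z * w) * Y ^ (r + s) = \<phi> (a * b)"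
    by (simp add: hom_mult power_add algebra_simps flip: zw)
  thus ?thesis by (rule K_I)
qed

lemma K_add [intro]: "z \<in> K \<Longrightarrow> w \<in> K \<Longrightarrow> z + w \<in> K"
proof (elim K_E)
  fix a b r s assume zw: "z * Y ^ r = \<phi> a" "w * Y ^ s = \<phi> b"
  hence "(z + w) * Y ^ (r + s) = \<phi> (a * fps_X ^ s + b * fps_X ^ r)"
    by (simp add: hom_simps power_add algebra_simps flip: zw Y_def)
  thus ?thesis by (rule K_I)
qed

lemma K_uminus [intro]: "z \<in> K \<Longrightarrow> - z \<in> K"
  using K_mult[OF K_phi[of "-1"]] by (simp add: hom_simps)

lemma K_diff [intro]: "z \<in> K \<Longrightarrow> w \<in> K \<Longrightarrow> z - w \<in> K"
  using K_add[of z "- w"] by auto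

lemma K_power [intro]: "z \<in> K \<Longrightarrow> z ^ i \<in> K"
  by (induction i) auto

lemma K_inverse [intro]: "z \<in> K \<Longrightarrow> inverse z \<in> K"
proof (cases "z = 0")
  case False
  assume "z \<in> K"
  then obtain a r where a: "z * Y ^ r = \<phi> a" by (rule K_E)
  with False have "\<phi> a \<noteq> 0" by (metis Y_nz mult_eq_0_iff power_not_zero)
  hence "\<not> f dvd a" by (simp add: kernel)
  then obtain s b where "f dvd fps_X ^ s - a * b" using power_X_multiple by blast
  hence "Y ^ s = \<phi> a * \<phi> b" by (simp add: phi_eq_iff[symmetric] hom_simps Y_def)
  hence "inverse z * Y ^ s = \<phi> (fps_X ^ r * b)"
    using False by (simp add: a[symmetric] hom_simps flip: Y_def)
  thus ?thesis by (rule K_I)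
qed simp

lemma K_divide [intro]: "z \<in> K \<Longrightarrow> w \<in> K \<Longrightarrow> z / w \<in> K"
  by (auto simp: divide_inverse)

text \<open>
  The extension of the intersection number with \<open>f\<close> to fractions. That it does not depend on the
  chosen representation is \<open>val_eq\<close>.
\<close>

definition val :: "'l \<Rightarrow> int" where
  "val z = (let (a, r) = (SOME (a, r). z * Y ^ r = \<phi> a) in int (len a) - int (r * n))"

lemma val_eq:
  assumes "z \<noteq> 0" "z * Y ^ r = \<phi> a"
  shows "val z = int (len a) - int (r * n)"
proof -
  obtain b s where bs: "(SOME (a, r). z * Y ^ r = \<phi> a) = (b, s)" by (cases "SOME (a, r). z * Y ^ r = \<phi> a")
  have "case (SOME (a, r). z * Y ^ r = \<phi> a) of (a, r) \<Rightarrow> z * Y ^ r = \<phi> a"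
    by (rule someI[of _ "(a, r)"]) (simp add: assms)
  hence b: "z * Y ^ s = \<phi> b" by (simp add: bs)
  have "\<phi> a \<noteq> 0" "\<phi> b \<noteq> 0" using assms(1) by (simp_all flip: b assms(2))
  hence nd: "\<not> f dvd a" "\<not> f dvd b" by (simp_all add: kernel)
  have "\<phi> (a * fps_X ^ s) = \<phi> (b * fps_X ^ r)"
    by (simp add: hom_simps mult_ac flip: b assms(2) Y_def)
  from len_cong[OF this] nd have "len a + s * n = len b + r * n"
    by (simp add: len_mult X_not_dvd len_X_power)
  thus ?thesis by (simp add: val_def bs flip: of_nat_add of_nat_mult)
qed

lemma val_phi: "\<not> f dvd a \<Longrightarrow> val (\<phi> a) = int (len a)"
  using val_eq[of "\<phi> a" 0 a] by (simp add: kernel)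

lemma val_mult:
  assumes "z \<in> K" "w \<in> K" "z \<noteq> 0" "w \<noteq> 0"
  shows "val (z * w) = val z + val w"
proof -
  from assms obtain a b r s where a: "z * Y ^ r = \<phi> a" and b: "w * Y ^ s = \<phi> b" by (elim K_E)
  have nd: "\<not> f dvd a" "\<not> f dvd b"
    using assms by (simp_all flip: kernel a b)
  have "z * w * Y ^ (r + s) = \<phi> (a * b)"
    by (simp add: hom_mult power_add algebra_simps flip: a b)
  with assms have "val (z * w) = int (len (a * b)) - int ((r + s) * n)" by (intro val_eq) auto
  also have "\<dots> = val z + val w"
    using val_eq[OF assms(3) a] val_eq[OF assms(4) b] nd by (simp add: len_mult algebra_simps)
  finally show ?thesis .
qed

lemma val_Y: "val Y = int n"
  using val_phi[of fps_X] X_not_dvd[of 1] by (simp add: Y_def len_X)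

lemma val_1: "val 1 = 0"
  using val_mult[of 1 1] by simp

lemma val_power: "z \<in> K \<Longrightarrow> z \<noteq> 0 \<Longrightarrow> val (z ^ i) = int i * val z"
  by (induction i) (auto simp: val_1 val_mult K_power algebra_simps)

lemma val_inverse: "z \<in> K \<Longrightarrow> z \<noteq> 0 \<Longrightarrow> val (inverse z) = - val z"
  using val_mult[of z "inverse z"] by (simp add: val_1 K_inverse)

lemma val_divide: "z \<in> K \<Longrightarrow> w \<in> K \<Longrightarrow> z \<noteq> 0 \<Longrightarrow> w \<noteq> 0 \<Longrightarrow> val (z / w) = val z - val w"
  by (simp add: divide_inverse val_mult val_inverse K_inverse)

end

section \<open>Residues and roots in the field of a branch\<close>

lemma pcompose_power_left: "pcompose (P ^ m) Q = pcompose P Q ^ m"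
  for P :: "'a::comm_ring_1 poly"
  by (induction m) (simp_all add: pcompose_mult pcompose_1)

context branch
begin

text \<open>
  Topological nilpotence of \<open>z\<close> in a form that does not mention a topology: some power of \<open>z\<close> carries
  the whole ring \<open>k[[y]][z]\<close> into \<open>y\<close> times the image of \<open>k[x][[y]]\<close>, where \<open>q\<close>-th roots of
  \<open>1 + y a\<close> can be extracted.
\<close>

definition small :: "'l \<Rightarrow> bool" where
  "small z \<longleftrightarrow> (\<exists>M. \<forall>P. \<exists>a. z ^ M * io.ev z P = Y * \<phi> a)"

lemma val_pos_if_small:
  assumes "small z" "z \<in> K" "z \<noteq> 0"
  shows "val z > 0"
proof -
  from assms(1) obtain M where "\<And>P. \<exists>a. z ^ M * io.ev z P = Y * \<phi> a" by (auto simp: small_def)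
  from this[of 1] obtain a where a: "z ^ M = Y * \<phi> a" by (auto simp: io.ev_1)
  with assms have nz: "\<phi> a \<noteq> 0" by auto
  have "int M * val z = val (Y * \<phi> a)" using assms by (simp add: val_power flip: a)
  also have "\<dots> = int n + int (len a)"
    using nz kernel[of a] by (simp add: val_mult val_Y val_phi)
  also have "\<dots> > 0" using n_pos by simp
  finally show ?thesis by (simp add: zero_less_mult_iff)
qed

text \<open>
  If the leading coefficient of a relation is a unit and all others are divisible by \<open>y\<close>, then
  \<open>z\<^sup>N\<close> lies in \<open>y k[[y]][z]\<close>, so high powers of \<open>z\<close> are divisible by high powers of \<open>y\<close> in \<open>k[[y]][z]\<close>. That ring
  is spanned over \<open>k[[y]]\<close> by finitely many powers of \<open>z\<close> and hence has a common denominator.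
\<close>

lemma small_if_monic_relation:
  assumes z: "z \<in> K" and rel: "(\<Sum>i\<le>N. \<iota> (p i) * z ^ i) = 0"
    and unit: "fps_nth (p N) 0 \<noteq> 0" and lower: "\<And>i. i < N \<Longrightarrow> fps_nth (p i) 0 = 0"
  shows "small z"
proof -
  define q where "q i = - (inverse (p N) * fps_shift 1 (p i))" for i
  define Q where "Q = (\<Sum>i<N. monom (q i) i)"
  have p: "p i = fps_X * fps_shift 1 (p i)" if "i < N" for i
    using fps_X_times_shift[OF lower[OF that]] by simp
  have inv: "inverse (p N) * p N = 1" using unit by (rule inverse_mult_eq_1)
  have evQ: "io.ev z Q = (\<Sum>i<N. \<iota> (q i) * z ^ i)" by (simp add: Q_def io.ev_sum io.ev_monom)
  have top: "\<iota> (p N) * z ^ N = - (\<Sum>i<N. \<iota> (p i) * z ^ i)"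
    using rel by (simp add: eq_neg_iff_add_eq_0 add.commute flip: lessThan_Suc_atMost)
  have "z ^ N = \<iota> (inverse (p N) * p N) * z ^ N" by (simp add: inv io.hom_one)
  also have "\<dots> = \<iota> (inverse (p N)) * (- (\<Sum>i<N. \<iota> (p i) * z ^ i))"
    by (simp add: io.hom_mult mult.assoc top)
  also have "(\<Sum>i<N. \<iota> (p i) * z ^ i) = Y * (\<Sum>i<N. \<iota> (fps_shift 1 (p i)) * z ^ i)"
    unfolding sum_distrib_left
    by (rule sum.cong, simp, subst p) (simp_all add: io.hom_mult Y_def mult.assoc)
  also have "\<iota> (inverse (p N)) * (- (Y * (\<Sum>i<N. \<iota> (fps_shift 1 (p i)) * z ^ i))) = Y * io.ev z Q"
    by (simp add: evQ q_def io.hom_uminus io.hom_mult sum_distrib_left mult_ac sum_negf)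
  finally have zN: "z ^ N = Y * io.ev z Q" .
  \<comment> \<open>The powers of \<open>z\<close> have a common denominator, because each exponent at least \<open>N\<close> can be lowered.\<close>
  have "\<exists>r a. z ^ i * Y ^ r = \<phi> a" for i using K_power[OF z, of i] unfolding K_def by blast
  then obtain r where r: "\<And>i. \<exists>a. z ^ i * Y ^ r i = \<phi> a" by metis
  define B where "B = (\<Sum>i<N. r i)"
  have B: "\<exists>a. Y ^ B * z ^ i = \<phi> a" for i
  proof (induction i rule: less_induct)
    case (less i)
    show ?case
    proof (cases "i < N")
      case True
      from r[of i] obtain a where a: "z ^ i * Y ^ r i = \<phi> a" by blast
      have "r i \<le> B" unfolding B_def using True by (intro member_le_sum) auto
      hence "Y ^ B = Y ^ (B - r i) * Y ^ r i" by (simp flip: power_add)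
      hence "Y ^ B * z ^ i = \<phi> (fps_X ^ (B - r i) * a)"
        by (simp add: hom_simps mult_ac flip: a Y_def)
      thus ?thesis by blast
    next
      case False
      have "\<exists>a. Y ^ B * z ^ (i - N + j) = \<phi> a" if "j < N" for j
        using less[of "i - N + j"] that False by simp
      then obtain a where a: "\<And>j. j < N \<Longrightarrow> Y ^ B * z ^ (i - N + j) = \<phi> (a j)" by metis
      have "Y ^ B * z ^ i = Y ^ B * z ^ (i - N) * z ^ N"
        using False by (simp add: mult.assoc flip: power_add)
      also have "\<dots> = (\<Sum>j<N. Y * \<iota> (q j) * (Y ^ B * z ^ (i - N + j)))"
        unfolding zN evQ by (simp add: sum_distrib_left power_add mult_ac)
      also have "\<dots> = (\<Sum>j<N. Y * \<iota> (q j) * \<phi> (a j))"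
        by (rule sum.cong) (simp_all add: a)
      also have "\<dots> = \<phi> (\<Sum>j<N. fps_X * x_const (q j) * a j)"
        by (simp add: hom_simps Y_def)
      finally show ?thesis by blast
    qed
  qed
  have BP: "\<exists>a. Y ^ B * io.ev z P = \<phi> a" for P
  proof -
    from B obtain a where a: "\<And>i. Y ^ B * z ^ i = \<phi> (a i)" by metis
    have "Y ^ B * io.ev z P = (\<Sum>i<Suc (degree P). \<iota> (coeff P i) * (Y ^ B * z ^ i))"
      by (subst io.ev_as_sum[OF lessI]) (simp add: sum_distrib_left mult_ac del: sum.lessThan_Suc)
    also have "\<dots> = \<phi> (\<Sum>i<Suc (degree P). x_const (coeff P i) * a i)"
      by (simp add: a hom_simps)
    finally show ?thesis by blast
  qed
  have "\<exists>a. z ^ (N * Suc B) * io.ev z P = Y * \<phi> a" for P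
  proof -
    from BP[of "Q ^ Suc B * P"] obtain a where "Y ^ B * io.ev z (Q ^ Suc B * P) = \<phi> a" by blast
    moreover have "z ^ (N * Suc B) * io.ev z P = Y * (Y ^ B * io.ev z (Q ^ Suc B * P))"
      unfolding power_mult zN by (simp add: power_mult_distrib io.ev_mult io.ev_power mult_ac)
    ultimately have "z ^ (N * Suc B) * io.ev z P = Y * \<phi> a" by (simp only:)
    thus ?thesis by blast
  qed
  thus ?thesis unfolding small_def by blast
qed

text \<open>
  A primitive relation of least degree for \<open>z\<close> cannot be factored. By Hensel's lemma its reduction
  modulo \<open>y\<close> is therefore a nonzero constant or a constant times a power \<open>(X - c)\<^sup>N\<close> of full degree.
  In the first case the reversed relation shows that \<open>1/z\<close> is topologically nilpotent, in the second
  the shifted relation shows it for \<open>z - c\<close>.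
\<close>

lemma residue_dichotomy:
  assumes z: "z \<in> K"
  shows "(\<exists>c. small (z - \<kappa> c)) \<or> z \<noteq> 0 \<and> small (inverse z)"
proof -
  from z obtain a s where a: "z * Y ^ s = \<phi> a" by (rule K_E)
  obtain P0 where P0: "P0 \<noteq> 0" "io.ev (\<phi> a) P0 = 0" using algebraic by blast
  \<comment> \<open>A relation for the numerator \<open>z y\<^sup>s\<close> becomes one for \<open>z\<close> by substitution.\<close>
  define P1 where "P1 = pcompose P0 [:0, fps_X ^ s:]"
  have "P1 \<noteq> 0" using P0(1) by (simp add: P1_def pcompose_eq_0_iff)
  moreover have "io.ev z [:0, fps_X ^ s:] = \<phi> a"
    by (simp add: io.ev_pCons io.ev_0 hom_simps xc.hom_power a flip: Y_def)
  hence "io.ev z P1 = 0" by (simp add: P1_def io.ev_pcompose P0(2))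
  ultimately obtain r P2 where P12: "P1 = smult (fps_X ^ r) P2" "red P2 \<noteq> 0"
    using primitive_part_exists by blast
  define Q where "Q P \<longleftrightarrow> red P \<noteq> 0 \<and> io.ev z P = 0" for P
  have "Q P2" using \<open>io.ev z P1 = 0\<close> \<open>red P2 \<noteq> 0\<close>
    unfolding Q_def P12(1) by (simp add: io.ev_smult)
  then obtain P where P: "Q P" and min: "\<And>P'. Q P' \<Longrightarrow> degree P \<le> degree P'"
    using ex_has_least_nat[of Q P2 degree] by metis
  define N where "N = degree P"
  have evP: "(\<Sum>i\<le>N. \<iota> (coeff P i) * z ^ i) = 0"
    using P io.ev_as_sum[of P "Suc N" z] by (simp add: Q_def N_def lessThan_Suc_atMost)
  have N_pos: "N > 0"
  proof (rule ccontr)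
    assume "\<not> N > 0"
    then obtain p where "P = [:p:]" using degree_eq_zeroE[of P] by (auto simp: N_def)
    with P show False by (auto simp: Q_def io.ev_pCons io.ev_0 red_pCons red_0)
  qed
  have irred: False if "red P = u * w" "s * u + t * w = 1" "0 < degree w" "degree w < N" for u w s t
  proof -
    have nz: "u \<noteq> 0" "w \<noteq> 0" using P that(1) by (auto simp: Q_def)
    from hensel_factorization_poly[OF that(1,2) nz] obtain U W where
      UW: "P = U * W" "red U = u" "red W = w" "degree U \<le> N - degree w" "degree W \<le> degree w"
      by (auto simp: N_def)
    from UW(1) P have "io.ev z U = 0 \<or> io.ev z W = 0" by (simp add: Q_def io.ev_mult)
    with UW nz have "Q U \<or> Q W" by (auto simp: Q_def)
    with min[of U] min[of W] UW(4,5) that(3,4) show False by (auto simp: N_def)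
  qed
  have deg: "degree (red P) \<le> N" using degree_red by (simp add: N_def)
  consider "degree (red P) = 0" | "0 < degree (red P)" "degree (red P) < N" | "degree (red P) = N"
    using deg by linarith
  thus ?thesis
  proof cases
    case 1
    \<comment> \<open>Only the constant coefficient is a unit: reversing the relation gives one for the inverse.\<close>
    then obtain c where c: "red P = [:c:]" by (rule degree_eq_zeroE)
    have "fps_nth (coeff P i) 0 = (if i = 0 then c else 0)" for i
      using coeff_red[of P i] by (cases i) (simp_all add: c)
    moreover have "c \<noteq> 0" using P c by (auto simp: Q_def)
    ultimately have co: "fps_nth (coeff P 0) 0 \<noteq> 0" "\<And>i. i > 0 \<Longrightarrow> fps_nth (coeff P i) 0 = 0" by auto
    have "z \<noteq> 0"
    proof
      assume "z = 0"
      hence "\<iota> (coeff P 0) = 0" using evP by (simp add: power_0_left if_distrib sum.delta cong: if_cong)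
      with co(1) show False by simp
    qed
    have "(\<Sum>i\<le>N. \<iota> (coeff P (N - i)) * inverse z ^ i) = inverse z ^ N * (\<Sum>i\<le>N. \<iota> (coeff P i) * z ^ i)"
    proof -
      have "(\<Sum>i\<le>N. \<iota> (coeff P (N - i)) * inverse z ^ i) = (\<Sum>i\<le>N. \<iota> (coeff P i) * inverse z ^ (N - i))"
        by (rule sum.reindex_bij_witness[of _ "\<lambda>i. N - i" "\<lambda>i. N - i"]) auto
      also have "\<dots> = (\<Sum>i\<le>N. inverse z ^ N * (\<iota> (coeff P i) * z ^ i))"
        using \<open>z \<noteq> 0\<close> by (intro sum.cong) (simp_all add: power_diff power_inverse field_simps)
      finally show ?thesis by (simp add: sum_distrib_left)
    qed
    hence "small (inverse z)"
      using co z evP by (intro small_if_monic_relation[where N = N and p = "\<lambda>i. coeff P (N - i)"]) auto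
    with \<open>z \<noteq> 0\<close> show ?thesis by blast
  next
    case 2
    \<comment> \<open>The factor with reduction \<open>1\<close> collects the roots whose inverses reduce to \<open>0\<close>.\<close>
    with irred[of 1 "red P" 1 0] show ?thesis by simp
  next
    case 3
    with N_pos have "degree (red P) > 0" by simp
    from alg_closed_imp_poly_has_root[OF this] obtain c where c: "poly (red P) c = 0" by blast
    define m where "m = order c (red P)"
    have rP: "red P \<noteq> 0" using P by (simp add: Q_def)
    from order_decomp[OF rP, of c] obtain u where
      u: "red P = [:- c, 1:] ^ m * u" "\<not> [:- c, 1:] dvd u" by (auto simp: m_def)
    have "m > 0" using c rP by (simp add: m_def order_gt_0_iff)
    have "u \<noteq> 0" using u(2) by auto
    have dm: "degree ([:- c, 1:] ^ m) = m" by (simp add: degree_power_eq)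
    have sum_deg: "m + degree u = N"
      using 3 \<open>u \<noteq> 0\<close> unfolding u(1) by (simp add: degree_mult_eq dm)
    have "degree u = 0"
    proof (rule ccontr)
      assume "degree u \<noteq> 0"
      have "poly u c \<noteq> 0" using u(2) by (simp add: poly_eq_0_iff_dvd)
      then obtain s t where "s * u + t * [:- c, 1:] ^ m = 1" by (rule bezout_root_power)
      with irred[of u "[:- c, 1:] ^ m" s t] u(1) \<open>m > 0\<close> sum_deg \<open>degree u \<noteq> 0\<close>
      show False by (simp add: mult.commute dm)
    qed
    with sum_deg have "m = N" by simp
    from \<open>degree u = 0\<close> obtain e where e: "u = [:e:]" by (rule degree_eq_zeroE)
    define P' where "P' = pcompose P [:fps_const c, 1:]"
    have "red P' = pcompose ([:- c, 1:] ^ N * [:e:]) [:c, 1:]"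
      using u(1) by (simp add: P'_def red_pcompose_linear e \<open>m = N\<close>)
    also have "\<dots> = [:0, 1:] ^ N * [:e:]"
      unfolding pcompose_mult pcompose_power_left by (simp add: pcompose_pCons)
    also have "\<dots> = monom e N" by (simp add: monom_altdef mult.commute)
    finally have co: "fps_nth (coeff P' i) 0 = (if i = N then e else 0)" for i
      using coeff_red[of P' i] by (auto split: if_splits)
    have "degree P' = N" by (simp add: P'_def N_def degree_pcompose)
    have "io.ev (z - \<kappa> c) P' = 0"
      using P by (simp add: P'_def io.ev_pcompose io.ev_pCons io.ev_0 io.ev_1 io.hom_one Q_def)
    hence "(\<Sum>i\<le>N. \<iota> (coeff P' i) * (z - \<kappa> c) ^ i) = 0"
      using io.ev_as_sum[of P' "Suc N" "z - \<kappa> c"] \<open>degree P' = N\<close> by (simp add: lessThan_Suc_atMost)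
    hence "small (z - \<kappa> c)"
      by (rule small_if_monic_relation[rotated]) (use z co e \<open>u \<noteq> 0\<close> in auto)
    thus ?thesis by blast
  qed
qed

lemma ev_map_fps_const: "io.ev z (map_poly fps_const C) = kk.ev z C"
proof -
  have "map_poly (\<lambda>w. \<phi> (x_const w)) (map_poly fps_const C) = map_poly \<kappa> C"
    by (subst map_poly_map_poly) (simp_all add: o_def)
  thus ?thesis by (simp add: io.ev_def kk.ev_def)
qed

lemma kk_ev_in_K: "z \<in> K \<Longrightarrow> kk.ev z C \<in> K"
  by (induction C) (auto simp: kk.ev_0 kk.ev_pCons)

text \<open>
  The truncated binomial series \<open>C(z)\<close> turns \<open>c + z\<close> into \<open>C(z)\<^sup>q (c + z) = 1 + z\<^sup>M R(z)\<close>, which for large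
  \<open>M\<close> is the image of some \<open>1 + y a\<close>; and that has a \<open>q\<close>-th root in \<open>k[x][[y]]\<close>.
\<close>

lemma root_of_const_plus_small:
  assumes "z \<in> K" "small z" "c \<noteq> 0" and q: "of_nat q \<noteq> (0 :: 'k)"
  shows "\<kappa> c + z \<noteq> 0" "\<exists>w\<in>K. w ^ q = \<kappa> c + z"
proof -
  from assms(2) obtain M where M: "\<And>P. \<exists>a. z ^ M * io.ev z P = Y * \<phi> a" by (auto simp: small_def)
  from truncated_root[OF \<open>c \<noteq> 0\<close> q] obtain C R :: "'k poly" where
    C: "C ^ q * [:c, 1:] = 1 + monom 1 M * R" by metis
  from M[of "map_poly fps_const R"] obtain a where a: "z ^ M * kk.ev z R = Y * \<phi> a"
    by (auto simp: ev_map_fps_const)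
  define u where "u = 1 + fps_X * a"
  have "kk.ev z (C ^ q * [:c, 1:]) = \<phi> u"
    unfolding C by (simp add: kk.ev_add kk.ev_mult kk.ev_1 kk.ev_monom io.hom_one mult.assoc a u_def hom_simps Y_def)
  hence eq: "kk.ev z C ^ q * (\<kappa> c + z) = \<phi> u"
    by (simp only: kk.ev_mult kk.ev_power) (simp add: kk.ev_pCons kk.ev_0 io.hom_one)
  have u0: "fps_nth u 0 = 1" by (simp add: u_def)
  obtain G where G: "G ^ q = u"
  proof (rule fps_root_exists[of u 1 q "[:inverse (of_nat q):]"])
    show "of_nat q * 1 ^ (q - 1) * [:inverse (of_nat q) :: 'k:] = 1"
      using q by (simp add: of_nat_poly flip: one_pCons)
  qed (use u0 in auto)
  from u0 have "u dvd 1" by (simp add: fps_dvd_1_iff)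
  then obtain u' where "1 = u * u'" by (elim dvdE)
  hence "\<phi> u * \<phi> u' = 1" by (metis hom_mult hom_one)
  hence nz: "\<phi> u \<noteq> 0" by auto
  with eq show "\<kappa> c + z \<noteq> 0" by auto
  have "kk.ev z C \<noteq> 0"
  proof
    assume 0: "kk.ev z C = 0"
    from q have "q > 0" by (cases q) auto
    with 0 eq nz show False by (simp add: power_0_left)
  qed
  have "\<phi> G ^ q = kk.ev z C ^ q * (\<kappa> c + z)"
    by (simp add: eq G flip: hom_power)
  hence "(\<phi> G / kk.ev z C) ^ q = \<kappa> c + z"
    using \<open>kk.ev z C \<noteq> 0\<close> by (simp add: power_divide)
  with K_divide[OF K_phi kk_ev_in_K[OF \<open>z \<in> K\<close>]]
  show "\<exists>w\<in>K. w ^ q = \<kappa> c + z" by blast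
qed

text \<open>The element has \<open>q\<close>-th roots for arbitrarily large \<open>q\<close>, so its value has arbitrarily large divisors.\<close>

lemma val_const_plus_small:
  assumes "z \<in> K" "small z" "c \<noteq> 0"
  shows "val (\<kappa> c + z) = 0"
proof (rule ccontr)
  assume nz: "val (\<kappa> c + z) \<noteq> 0"
  define m where "m = nat \<bar>val (\<kappa> c + z)\<bar>"
  \<comment> \<open>Two consecutive integers cannot both vanish in \<open>'k\<close>.\<close>
  obtain q where q: "q > m" "of_nat q \<noteq> (0 :: 'k)"
  proof (cases "of_nat (Suc m) = (0 :: 'k)")
    case True
    hence "of_nat (Suc (Suc m)) \<noteq> (0 :: 'k)" by simp
    with that[of "Suc (Suc m)"] show ?thesis by simp
  qed (use that[of "Suc m"] in auto)
  from root_of_const_plus_small[OF assms q(2)] obtain w where w: "w \<in> K" "w ^ q = \<kappa> c + z" "\<kappa> c + z \<noteq> 0" by blast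
  have "w \<noteq> 0" using w q by (cases q) auto
  with w have "val (\<kappa> c + z) = int q * val w" by (metis val_power)
  with nz q(1) show False
    using dvd_imp_le_int[of "val (\<kappa> c + z)" "int q"] by (simp add: m_def)
qed

lemma root_if_val_eq_0:
  assumes "z \<in> K" "z \<noteq> 0" "val z = 0" "of_nat q \<noteq> (0 :: 'k)"
  shows "\<exists>w\<in>K. w ^ q = z"
proof -
  have "\<not> small (inverse z)"
    using val_pos_if_small[of "inverse z"] assms by (auto simp: val_inverse K_inverse)
  with residue_dichotomy[OF assms(1)] obtain c where c: "small (z - \<kappa> c)" by blast
  have "c \<noteq> 0"
  proof
    assume "c = 0"
    with c assms show False using val_pos_if_small[of z] by (simp add: io.hom_zero)
  qed
  from root_of_const_plus_small(2)[OF _ c this assms(4)] assms(1) show ?thesis by (simp add: K_diff)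
qed

end

section \<open>Uniformizers\<close>

context branch
begin

definition valring :: "'l set" where "valring = {z \<in> K. z = 0 \<or> val z \<ge> 0}"

lemma valring_in_K: "z \<in> valring \<Longrightarrow> z \<in> K"
  by (simp add: valring_def)

lemma valring_residue:
  assumes "z \<in> valring"
  shows "\<exists>c. small (z - \<kappa> c)"
proof (rule ccontr)
  assume *: "\<nexists>c. small (z - \<kappa> c)"
  with residue_dichotomy[OF valring_in_K[OF assms]] have z: "z \<noteq> 0" "small (inverse z)" by blast+
  hence "val (inverse z) > 0" using valring_in_K[OF assms] by (intro val_pos_if_small) auto
  with z assms show False by (simp add: valring_def val_inverse)
qed

lemma valring_mult: "z \<in> valring \<Longrightarrow> w \<in> valring \<Longrightarrow> z * w \<in> valring"
  by (cases "z = 0"; cases "w = 0") (auto simp: valring_def val_mult)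

lemma valring_phi: "\<phi> a \<in> valring"
  using val_phi[of a] kernel[of a] by (cases "f dvd a") (auto simp: valring_def)

lemma valring_power: "z \<in> valring \<Longrightarrow> z ^ i \<in> valring"
  by (induction i) (use valring_phi[of 1] in \<open>auto simp: valring_mult hom_one\<close>)

text \<open>
  The ultrametric inequality. The value was defined by dimensions and is only known to be
  multiplicative; additive information comes from writing \<open>w/z\<close> as a constant plus a topologically
  nilpotent element.
\<close>

lemma valring_add_aux:
  assumes z: "z \<in> valring" "w \<in> valring" and nz: "z \<noteq> 0" "w \<noteq> 0" "z + w \<noteq> 0" and le: "val z \<le> val w"
  shows "z + w \<in> valring"
proof -
  note K = valring_in_K[OF z(1)] valring_in_K[OF z(2)]
  have "w / z \<in> valring" using K nz le by (auto simp: valring_def val_divide)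
  then obtain c where c: "small (w / z - \<kappa> c)" using valring_residue by blast
  define s where "s = w / z - \<kappa> c"
  have "s \<in> K" using K by (auto simp: s_def)
  have eq: "z + w = z * (\<kappa> (1 + c) + s)"
    using nz(1) by (simp add: s_def kk.hom_add io.hom_one field_simps del: fps_const_add)
  have "val (\<kappa> (1 + c) + s) \<ge> 0"
  proof (cases "1 + c = 0")
    case True
    with eq nz have "s \<noteq> 0" by (auto simp: hom_zero simp del: fps_const_add)
    with c \<open>s \<in> K\<close> have "val s > 0" by (auto simp: s_def intro: val_pos_if_small)
    with True show ?thesis by (simp add: io.hom_zero)
  next
    case False
    with c \<open>s \<in> K\<close> show ?thesis by (simp add: s_def val_const_plus_small)
  qed
  moreover have "\<kappa> (1 + c) + s \<in> K" "\<kappa> (1 + c) + s \<noteq> 0"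
    using \<open>s \<in> K\<close> eq nz by auto
  ultimately have "val (z + w) \<ge> 0"
    unfolding eq using z nz K by (subst val_mult) (auto simp: valring_def)
  thus ?thesis using K by (auto simp: valring_def)
qed

lemma valring_add: "z \<in> valring \<Longrightarrow> w \<in> valring \<Longrightarrow> z + w \<in> valring"
proof -
  assume zw: "z \<in> valring" "w \<in> valring"
  consider "z = 0" | "w = 0" | "z + w = 0" | "z \<noteq> 0" "w \<noteq> 0" "z + w \<noteq> 0" by blast
  thus ?thesis
  proof cases
    case 4
    show ?thesis
    proof (cases "val z \<le> val w")
      case False
      thus ?thesis using valring_add_aux[of w z] zw 4 by (simp add: add.commute)
    qed (use valring_add_aux zw 4 in blast)
  qed (use zw valring_phi[of 0] in \<open>auto simp: hom_zero\<close>)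
qed

lemma valring_diff: "z \<in> valring \<Longrightarrow> w \<in> valring \<Longrightarrow> z - w \<in> valring"
  using valring_add[of z "\<phi> (-1) * w"] valring_mult[OF valring_phi, of w "-1"] by (simp add: hom_simps)

lemma valring_sum: "(\<And>i. i \<in> I \<Longrightarrow> F i \<in> valring) \<Longrightarrow> sum F I \<in> valring"
  by (induction I rule: infinite_finite_induct) (use valring_phi[of 0] in \<open>auto simp: valring_add hom_zero\<close>)

text \<open>
  Subtracting the residue of \<open>z'\<close> leaves an element of positive value, hence of value at least that of
  \<open>p\<close>, so that one may divide by \<open>p\<close> and continue.
\<close>

lemma digit_expansion:
  assumes p: "p \<in> K" "p \<noteq> 0" "val p > 0" and min: "\<And>z. z \<in> K \<Longrightarrow> z \<noteq> 0 \<Longrightarrow> val z > 0 \<Longrightarrow> val p \<le> val z"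
    and z: "z \<in> valring"
  shows "\<exists>c z'. z' \<in> valring \<and> z = (\<Sum>i<m. \<kappa> (c i) * p ^ i) + p ^ m * z'"
proof (induction m)
  case 0
  show ?case using z by auto
next
  case (Suc m)
  then obtain c z' where c: "z' \<in> valring" "z = (\<Sum>i<m. \<kappa> (c i) * p ^ i) + p ^ m * z'" by blast
  obtain d where d: "small (z' - \<kappa> d)" using valring_residue[OF c(1)] by blast
  have K: "z' - \<kappa> d \<in> K" using valring_in_K[OF c(1)] by auto
  define z'' where "z'' = (z' - \<kappa> d) / p"
  have "z'' \<in> valring"
  proof (cases "z' - \<kappa> d = 0")
    case False
    with K d have "val (z' - \<kappa> d) > 0" by (intro val_pos_if_small)
    with min[OF K False] False K p show ?thesis by (auto simp: valring_def z''_def val_divide)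
  qed (use valring_phi[of 0] in \<open>simp add: z''_def hom_zero\<close>)
  moreover have "z' = \<kappa> d + p * z''" using p(2) by (simp add: z''_def)
  hence "z = (\<Sum>i<Suc m. \<kappa> ((c(m := d)) i) * p ^ i) + p ^ Suc m * z''"
    using c(2) by (simp add: algebra_simps)
  ultimately show ?case by blast
qed

text \<open>
  Since \<open>p\<^sup>e\<close> is \<open>y\<close> times a unit, \<open>e\<close> digits give \<open>z\<close> modulo \<open>y\<close>. Repeating this collects for each
  power of \<open>p\<close> the digits of a power series in \<open>y\<close>. The difference between \<open>z\<close> and the resulting
  combination is divisible by every power of \<open>y\<close> in the valuation ring and is therefore zero.
\<close>

lemma valring_spanned_by_powers:
  assumes p: "p \<in> K" "p \<noteq> 0" "val p > 0" and min: "\<And>z. z \<in> K \<Longrightarrow> z \<noteq> 0 \<Longrightarrow> val z > 0 \<Longrightarrow> val p \<le> val z"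
    and e: "int n = val p * int e" and z: "z \<in> valring"
  shows "\<exists>w. z = (\<Sum>i<e. \<iota> (w i) * p ^ i)"
proof -
  define u where "u = p ^ e / Y"
  have "val u = 0" using p e by (auto simp: u_def val_divide val_power val_Y K_power)
  hence u: "u \<in> valring" using p by (auto simp: valring_def u_def)
  have p_int: "p \<in> valring" using p by (simp add: valring_def)
  have "\<exists>c z'. z' \<in> valring \<and> z = (\<Sum>i<e. \<kappa> (c i) * p ^ i) + Y * z'" if z: "z \<in> valring" for z
  proof -
    obtain c z' where c: "z' \<in> valring" "z = (\<Sum>i<e. \<kappa> (c i) * p ^ i) + p ^ e * z'"
      using digit_expansion[OF p min z] by blast
    have "p ^ e * z' = Y * (u * z')" by (simp add: u_def)
    with c valring_mult[OF u c(1)] show ?thesis by metis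
  qed
  then obtain C T where CT: "\<And>z. z \<in> valring \<Longrightarrow> T z \<in> valring"
    "\<And>z. z \<in> valring \<Longrightarrow> z = (\<Sum>i<e. \<kappa> (C z i) * p ^ i) + Y * T z" by metis
  \<comment> \<open>The digits of \<open>z\<close> at \<open>p\<^sup>i\<close>, collected into a power series.\<close>
  define w where "w z i = Abs_fps (\<lambda>r. C ((T ^^ r) z) i)" for z i
  have w_rec: "w z i = fps_const (C z i) + fps_X * w (T z) i" for z i
  proof (rule fps_ext)
    fix r show "fps_nth (w z i) r = fps_nth (fps_const (C z i) + fps_X * w (T z) i) r"
      by (cases r) (simp_all add: w_def funpow_swap1)
  qed
  define \<Theta> where "\<Theta> z = (\<Sum>i<e. \<iota> (w z i) * p ^ i)" for z
  have \<Theta>_int: "\<Theta> z \<in> valring" for z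
    unfolding \<Theta>_def by (intro valring_sum valring_mult valring_phi valring_power p_int)
  have \<Theta>_rec: "\<Theta> z = (\<Sum>i<e. \<kappa> (C z i) * p ^ i) + Y * \<Theta> (T z)" for z
    unfolding \<Theta>_def
    by (subst w_rec) (simp add: io.hom_add io.hom_mult Y_def algebra_simps sum.distrib sum_distrib_left)
  have step: "z - \<Theta> z = Y * (T z - \<Theta> (T z))" if "z \<in> valring" for z
    using CT(2)[OF that] \<Theta>_rec[of z] by (simp add: algebra_simps)
  have T_int: "(T ^^ r) z \<in> valring" for r by (induction r) (simp_all add: z CT(1))
  have iter: "z - \<Theta> z = Y ^ r * ((T ^^ r) z - \<Theta> ((T ^^ r) z))" for r
    by (induction r) (simp_all add: step[OF T_int])
  have "z - \<Theta> z = 0"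
  proof (rule ccontr)
    assume nz: "z - \<Theta> z \<noteq> 0"
    \<comment> \<open>The value of \<open>y\<close> is \<open>n\<close>, at least \<open>1\<close>, so divisibility by \<open>y\<^sup>r\<close> forces a value of at least \<open>r\<close>.\<close>
    define r where "r = Suc (nat (val (z - \<Theta> z)))"
    define d where "d = (T ^^ r) z - \<Theta> ((T ^^ r) z)"
    have d: "d \<in> valring" unfolding d_def by (intro valring_diff T_int \<Theta>_int)
    have dn: "d \<noteq> 0" using nz iter[of r] by (auto simp: d_def)
    have "val (z - \<Theta> z) = val (Y ^ r * d)" by (subst iter[of r]) (simp add: d_def)
    also have "\<dots> = int r * int n + val d"
      using d dn by (simp add: valring_def val_mult val_power val_Y K_power)
    also have "\<dots> \<ge> int r * 1 + 0"
      using d dn n_pos by (intro add_mono mult_left_mono) (auto simp: valring_def)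
    finally have "int r \<le> val (z - \<Theta> z)" by simp
    moreover have "x \<le> int (nat x)" for x :: int by simp
    from this[of "val (z - \<Theta> z)"] have "val (z - \<Theta> z) < int r" by (simp only: r_def of_nat_Suc)
    ultimately show False by simp
  qed
  thus ?thesis by (auto simp: \<Theta>_def)
qed

lemma uniformizer_exists: "\<exists>p\<in>K. p \<noteq> 0 \<and> val p = 1"
proof -
  define D where "D d \<longleftrightarrow> d > 0 \<and> (\<exists>p\<in>K. p \<noteq> 0 \<and> val p = int d)" for d :: nat
  have "D n" using n_pos val_Y by (auto simp: D_def intro: bexI[of _ Y])
  hence "D (LEAST d. D d)" by (rule LeastI)
  then obtain d p where d: "d = (LEAST d. D d)" "d > 0" and p: "p \<in> K" "p \<noteq> 0" "val p = int d"
    by (auto simp: D_def)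
  have min: "val p \<le> val z" if "z \<in> K" "z \<noteq> 0" "val z > 0" for z
  proof -
    have "D (nat (val z))" using that by (auto simp: D_def)
    hence "d \<le> nat (val z)" unfolding d(1) by (rule Least_le)
    with that p show ?thesis by simp
  qed
  define e where "e = n div d"
  have "n mod d = 0"
  proof (rule ccontr)
    assume "n mod d \<noteq> 0"
    have "val (Y / p ^ e) = int n - int e * int d"
      using p by (simp add: val_divide val_power val_Y K_power)
    also have "\<dots> = int (n mod d)"
      by (metis e_def minus_div_mult_eq_mod of_nat_mult zdiv_int zmod_int)
    finally have "val (Y / p ^ e) = int (n mod d)" .
    moreover have "Y / p ^ e \<in> K" "Y / p ^ e \<noteq> 0" using p by auto
    ultimately have "int d \<le> int (n mod d)"
      using min[of "Y / p ^ e"] p \<open>n mod d \<noteq> 0\<close> by simp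
    hence "d \<le> n mod d" by simp
    with mod_less_divisor[OF \<open>d > 0\<close>, of n] show False by linarith
  qed
  hence e: "n = d * e" by (auto simp: e_def)
  have "n \<le> e"
  proof (rule ccontr)
    assume "\<not> n \<le> e"
    hence "e < n" by simp
    have "\<exists>w. \<xi> ^ j = (\<Sum>i<e. \<iota> (w i) * p ^ i)" for j
      using valring_spanned_by_powers[OF p(1,2) _ min, of e "\<xi> ^ j"] p(3) d(2) e valring_power[OF valring_phi]
      by (simp add: \<xi>_def)
    then obtain w where w: "\<And>j. \<xi> ^ j = (\<Sum>i<e. \<iota> (w j i) * p ^ i)" by metis
    from exists_linear_relation[OF \<open>e < n\<close>, of w] obtain u where
      u: "\<exists>j<n. u j \<noteq> 0" "\<forall>i<e. (\<Sum>j<n. u j * w j i) = 0" by blast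
    define P where "P = (\<Sum>j<n. monom (u j) j)"
    have cP: "coeff P j = u j" if "j < n" for j using that by (simp add: P_def coeff_sum)
    have "io.ev \<xi> P = (\<Sum>j<n. \<iota> (u j) * \<xi> ^ j)" by (simp add: P_def io.ev_sum io.ev_monom)
    also have "\<dots> = (\<Sum>j<n. \<Sum>i<e. \<iota> (u j * w j i) * p ^ i)"
      unfolding w by (simp add: sum_distrib_left io.hom_mult mult.assoc)
    also have "\<dots> = (\<Sum>i<e. \<iota> (\<Sum>j<n. u j * w j i) * p ^ i)"
      by (subst sum.swap) (simp add: io.hom_sum sum_distrib_right)
    also have "\<dots> = 0" using u(2) by (simp add: io.hom_zero)
    finally have "io.ev \<xi> P = 0" .
    moreover have "degree P < n"
      unfolding P_def using n_pos by (intro degree_sum_less) (auto intro: le_less_trans[OF degree_monom_le])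
    ultimately have "P = 0" by (intro small_degree_inj)
    with cP u(1) show False by (metis coeff_0)
  qed
  with e n_pos have "d = 1" by (cases d rule: nat.exhaust) auto
  with p show ?thesis by auto
qed

text \<open>Dividing by a power of a uniformizer with exponent divisible by \<open>q\<close> reduces to value \<open>0\<close>.\<close>

theorem power_residue_if_len_dvd:
  assumes g: "\<not> f dvd g" and "q dvd len g" and q: "of_nat q \<noteq> (0 :: 'k)"
  shows "\<exists>a b. \<not> f dvd b \<and> f dvd g * b ^ q - a ^ q"
proof -
  obtain m where m: "len g = q * m" using assms(2) by (elim dvdE)
  obtain p where p: "p \<in> K" "p \<noteq> 0" "val p = 1" using uniformizer_exists by blast
  have gn: "\<phi> g \<noteq> 0" using g by (simp add: kernel)
  define z where "z = \<phi> g / p ^ (q * m)"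
  have "val z = 0" using p gn g m by (simp add: z_def val_divide val_power val_phi K_power)
  moreover have "z \<in> K" "z \<noteq> 0" using p gn by (auto simp: z_def)
  ultimately obtain w where w: "w \<in> K" "w ^ q = z" using root_if_val_eq_0 q by blast
  have "w * p ^ m \<in> K" using w p by auto
  then obtain a r where a: "w * p ^ m * Y ^ r = \<phi> a" by (rule K_E)
  have "\<phi> g = (w * p ^ m) ^ q"
    using p by (simp add: power_mult_distrib w z_def power_mult mult.commute)
  hence "\<phi> (g * (fps_X ^ r) ^ q) = \<phi> (a ^ q)"
    by (simp add: hom_simps power_mult_distrib flip: a Y_def)
  thus ?thesis using X_not_dvd[of r] by (auto simp: phi_eq_iff)
qed

end

section \<open>Every irreducible series defines a branch\<close>

instance fps :: (field) semiring_gcd_mult_normalize ..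

lemma monic_division:
  fixes P W :: "'a::idom poly"
  assumes "lead_coeff W = 1" "degree W > 0"
  obtains S T where "P = W * S + T" "degree T < degree W"
proof -
  have W: "W \<noteq> 0" using assms(1) by auto
  obtain S T where "pseudo_divmod P W = (S, T)" by fastforce
  from pseudo_divmod[OF W this] assms have "P = W * S + T" "degree T < degree W" by auto
  thus ?thesis by (rule that)
qed

text \<open>
  Dividing \<open>x\<^sup>n\<close> by \<open>f\<close> gives \<open>x\<^sup>n - P = f Q\<close>; modulo \<open>y\<close> both sides have degree \<open>n\<close>, so \<open>Q\<close> is a unit.
\<close>

lemma weierstrass_preparation:
  fixes f :: "'k::field poly fps"
  assumes "fps_nth f 0 \<noteq> 0" "degree (fps_nth f 0) > 0"
  obtains W Q Q' where "as_series W = f * Q" "Q * Q' = 1" "lead_coeff W = 1"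
    "degree W = degree (fps_nth f 0)"
proof -
  define n where "n = degree (fps_nth f 0)"
  obtain P where P: "degree P < n" "f dvd as_series (monom 1 n) - as_series P"
    using weierstrass_remainder[OF assms] unfolding n_def by blast
  then obtain Q where Q: "as_series (monom 1 n) - as_series P = f * Q" by (elim dvdE)
  define W where "W = monom 1 n - P"
  have cW: "coeff W n = 1" using P(1) by (simp add: W_def coeff_eq_0)
  have dW: "degree W = n"
  proof (rule antisym)
    show "degree W \<le> n" unfolding W_def using P(1) by (intro degree_diff_le degree_monom_le) auto
    show "n \<le> degree W" using cW by (intro le_degree) simp
  qed
  have eq: "as_series W = f * Q" by (simp add: W_def sr.hom_diff Q)
  have "coeff (fps_nth (as_series W) 0) n = 1" using cW by (simp add: as_series_coeff)
  hence "coeff (fps_nth f 0 * fps_nth Q 0) n = 1" by (simp add: eq)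
  moreover have "degree (fps_nth f 0 * fps_nth Q 0) \<le> n"
    using degree_as_series_nth[of W 0] by (simp add: eq dW)
  ultimately have Q0: "fps_nth Q 0 \<noteq> 0" "degree (fps_nth Q 0) = 0"
    using assms(1) by (cases "fps_nth Q 0 = 0"; simp add: degree_mult_eq n_def)+
  hence "fps_nth Q 0 dvd 1" by (simp add: is_unit_iff_degree)
  hence "Q dvd 1" by (simp add: fps_dvd_1_iff)
  then obtain Q' where "Q * Q' = 1" by (metis dvdE)
  with eq cW dW show ?thesis by (intro that) (auto simp: n_def)
qed

text \<open>
  The leading coefficients of factors of a monic polynomial are units. Such a factor keeps its degree
  modulo \<open>y\<close>, so it can be a unit of \<open>k[x][[y]]\<close> only if it is constant.
\<close>

lemma weierstrass_poly_irreducible: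
  fixes f :: "'k::field poly fps"
  assumes irr: "Factorial_Ring.irreducible f" and W: "as_series W = f * Q" "Q * Q' = 1" "lead_coeff W = 1" "degree W > 0"
  shows "Factorial_Ring.irreducible W"
proof (rule Factorial_Ring.irreducibleI)
  show "W \<noteq> 0" using W(3) by auto
  show "\<not> W dvd 1" using W(4) by (auto simp: is_unit_poly_iff)
  fix A B assume AB: "W = A * B"
  have lead: "fps_nth (lead_coeff A) 0 * fps_nth (lead_coeff B) 0 = 1"
    using W(3) unfolding AB lead_coeff_mult by (metis fps_mult_nth_0 fps_one_nth)
  have unit: "C dvd 1" if "as_series C dvd 1" "fps_nth (lead_coeff C) 0 \<noteq> 0" for C :: "'k fps poly"
  proof -
    from that(1) have "red C dvd 1" by (simp add: fps_dvd_1_iff red_def)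
    hence "degree (red C) = 0" by (auto simp: is_unit_poly_iff)
    moreover have "degree C \<le> degree (red C)"
      using that(2) by (intro le_degree) (simp add: coeff_red)
    ultimately obtain a where "C = [:a:]" using degree_eq_zeroE[of C] by auto
    with that(2) show ?thesis by (simp add: is_unit_const_poly_iff)
  qed
  have "f = as_series A * (as_series B * Q')"
  proof -
    have "f = f * Q * Q'" using W(2) by (simp add: mult.assoc)
    thus ?thesis by (simp add: AB sr.hom_mult mult.assoc flip: W(1))
  qed
  from irreducibleD[OF irr this] have "as_series A dvd 1 \<or> as_series B dvd 1"
    by (auto dest: dvd_mult_left)
  moreover have "fps_nth (lead_coeff A) 0 \<noteq> 0" "fps_nth (lead_coeff B) 0 \<noteq> 0"
    using lead by (metis mult_zero_left mult_zero_right zero_neq_one)+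
  ultimately show "A dvd 1 \<or> B dvd 1" using unit by blast
qed

text \<open>
  By the lemma of Gauss the Weierstrass polynomial \<open>W\<close> is irreducible over the fraction field of
  \<open>k[[y]]\<close>, hence is the minimal polynomial of each of its roots \<open>\<xi>\<close>. The map takes a series to its
  Weierstrass remainder evaluated at \<open>\<xi>\<close>. It is a homomorphism since a polynomial over \<open>k[[y]]\<close> that is
  a multiple of \<open>f\<close> in \<open>k[x][[y]]\<close> is already a multiple of \<open>W\<close> as a polynomial.
\<close>

lemma branch_exists:
  fixes f :: "'k::alg_closed_field poly fps"
  assumes irr: "Factorial_Ring.irreducible f" and f0: "fps_nth f 0 \<noteq> 0"
  shows "\<exists>\<phi> :: 'k poly fps \<Rightarrow> 'k fps fract alg_closure. branch \<phi> f"
proof -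
  define n where "n = degree (fps_nth f 0)"
  have n: "n > 0"
  proof (rule ccontr)
    assume "\<not> n > 0"
    with f0 have "fps_nth f 0 dvd 1" by (simp add: n_def is_unit_iff_degree)
    hence "f dvd 1" by (simp add: fps_dvd_1_iff)
    with irr show False by (simp add: Factorial_Ring.irreducible_def)
  qed
  from weierstrass_preparation[OF f0] n obtain W Q Q' where
    W: "as_series W = f * Q" "Q * Q' = 1" "lead_coeff W = 1" "degree W = n"
    unfolding n_def by blast
  have "Factorial_Ring.irreducible W" using weierstrass_poly_irreducible[OF irr W(1-3)] W(4) n by simp
  hence irrW: "Factorial_Ring.irreducible (fract_poly W)"
    using nonconst_poly_irreducible_iff[of W] W(4) n by simp
  define h :: "'k fps \<Rightarrow> 'k fps fract alg_closure" where "h = to_ac \<circ> to_fract"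
  interpret h: unital_hom h
    by unfold_locales (simp_all add: h_def)
  have h_inj: "h w = 0 \<longleftrightarrow> w = 0" for w by (simp add: h_def)
  have ac: "map_poly h P = map_poly to_ac (fract_poly P)" for P
    by (subst map_poly_map_poly) (simp_all add: h_def)
  have "degree (map_poly h W) = n"
    using W(4) by (subst degree_map_poly) (auto simp: h_inj)
  with n obtain \<xi> where "poly (map_poly h W) \<xi> = 0" using alg_closed_imp_poly_has_root by metis
  hence \<xi>: "h.ev \<xi> W = 0" by (simp add: h.ev_def)
  \<comment> \<open>No nonzero polynomial of smaller degree vanishes at \<open>\<xi>\<close>.\<close>
  have small_inj: "P = 0" if "degree P < n" "h.ev \<xi> P = 0" for P
  proof (rule ccontr)
    assume "P \<noteq> 0"
    define Z where "Z p \<longleftrightarrow> p \<noteq> 0 \<and> poly (map_poly to_ac p) \<xi> = 0" for p :: "'k fps fract poly"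
    have "Z (fract_poly P)" using that \<open>P \<noteq> 0\<close> by (simp add: Z_def h.ev_def ac)
    then obtain p where p: "Z p" and min: "\<And>p'. Z p' \<Longrightarrow> degree p \<le> degree p'"
      using ex_has_least_nat[of Z _ degree] by metis
    interpret ta: unital_hom "to_ac :: 'k fps fract \<Rightarrow> _" by unfold_locales simp_all
    have "fract_poly W = p * (fract_poly W div p) + fract_poly W mod p" by simp
    hence "ta.ev \<xi> (fract_poly W) = ta.ev \<xi> p * ta.ev \<xi> (fract_poly W div p) + ta.ev \<xi> (fract_poly W mod p)"
      by (metis ta.ev_add ta.ev_mult)
    hence "ta.ev \<xi> (fract_poly W mod p) = 0"
      using \<xi> p by (simp add: ta.ev_def Z_def h.ev_def ac)
    moreover have "\<not> Z (fract_poly W mod p)"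
      using min[of "fract_poly W mod p"] degree_mod_less[of p "fract_poly W"] p
      by (auto simp: Z_def)
    ultimately have "fract_poly W mod p = 0" by (auto simp: Z_def ta.ev_def)
    hence "p dvd fract_poly W" by (simp add: dvd_eq_mod_eq_0)
    then obtain s where s: "fract_poly W = p * s" by (elim dvdE)
    from irreducibleD[OF irrW s] show False
    proof
      assume "p dvd 1"
      then obtain c where "p = [:c:]" "c dvd 1" by (auto simp: is_unit_poly_iff)
      with p ta.ev_pCons[of \<xi> c 0] show False by (simp add: Z_def ta.ev_def)
    next
      assume "s dvd 1"
      hence "degree s = 0" "s \<noteq> 0" by (auto simp: is_unit_poly_iff)
      with s p have "degree p = degree (fract_poly W)" by (simp add: degree_mult_eq Z_def)
      moreover have "degree (fract_poly W) = n" using W(4) by (subst degree_map_poly) auto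
      moreover have "degree (fract_poly P) = degree P" by (rule degree_map_poly) auto
      ultimately show False using min[OF \<open>Z (fract_poly P)\<close>] that(1) by simp
    qed
  qed
  have key: "h.ev \<xi> P = 0" if "f dvd as_series P" for P
  proof -
    obtain S T where ST: "P = W * S + T" "degree T < n"
      using monic_division[OF W(3), of P] W(4) n by auto
    have "T = P - W * S" using ST(1) by simp
    hence "f dvd as_series T" using that by (simp add: sr.hom_diff sr.hom_mult W(1))
    hence "T = 0" using dvd_as_series_imp_zero[OF _ f0] ST(2) by (simp add: n_def)
    with ST(1) show ?thesis by (simp add: h.ev_mult \<xi>)
  qed
  have "\<exists>P. degree P < n \<and> f dvd a - as_series P" for a
    using weierstrass_remainder[OF f0] n unfolding n_def by metis
  then obtain p where p: "\<And>a. degree (p a) < n" "\<And>a. f dvd a - as_series (p a)" by metis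
  define \<phi> where "\<phi> a = h.ev \<xi> (p a)" for a
  have phi: "\<phi> a = h.ev \<xi> P" if "f dvd a - as_series P" for a P
  proof -
    have "f dvd (a - as_series P) - (a - as_series (p a))" using that p(2) by (rule dvd_diff)
    hence "f dvd as_series (p a - P)" by (simp add: sr.hom_diff)
    from key[OF this] show ?thesis by (simp add: h.ev_diff \<phi>_def)
  qed
  have "branch \<phi> f"
  proof (unfold_locales, goal_cases)
    case (1 a b)
    have "f dvd (a - as_series (p a)) + (b - as_series (p b))" using p(2) by (intro dvd_add)
    hence "f dvd (a + b) - as_series (p a + p b)" by (simp add: sr.hom_add algebra_simps)
    from phi[OF this] show ?case by (simp add: h.ev_add \<phi>_def)
  next
    case (2 a b)
    have "f dvd (a - as_series (p a)) * b + as_series (p a) * (b - as_series (p b))"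
      using p(2) by (intro dvd_add dvd_mult dvd_mult2)
    hence "f dvd a * b - as_series (p a * p b)" by (simp add: sr.hom_mult algebra_simps)
    from phi[OF this] show ?case by (simp add: h.ev_mult \<phi>_def)
  next
    case 3
    show ?case using phi[of 1 1] by (simp add: sr.hom_one h.ev_1)
  next
    case 4
    show ?case by (rule f0)
  next
    case (5 a)
    show ?case
    proof
      assume "\<phi> a = 0"
      hence "p a = 0" using small_inj p(1) by (simp add: \<phi>_def)
      with p(2)[of a] show "f dvd a" by (simp add: sr.hom_zero)
    next
      assume "f dvd a"
      with phi[of a 0] show "\<phi> a = 0" by (simp add: sr.hom_zero h.ev_0)
    qed
  qed
  thus ?thesis by blast
qed

section \<open>Reciprocity of power residues\<close>

text \<open>An irreducible series that is divisible by \<open>y\<close> is associated to \<open>y\<close>.\<close>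

lemma irreducible_nth_0_eq_0:
  fixes f :: "'k::alg_closed_field poly fps"
  assumes "Factorial_Ring.irreducible f" "fps_nth f 0 = 0"
  shows "f dvd a \<longleftrightarrow> fps_nth a 0 = 0"
proof -
  from fps_X_times_shift[OF assms(2)] have f: "f = fps_X * fps_shift 1 f" by simp
  have "\<not> fps_X dvd (1 :: 'k poly fps)" by (simp add: fps_dvd_1_iff)
  with irreducibleD[OF assms(1) f] obtain u where u: "1 = fps_shift 1 f * u" by (auto elim: dvdE)
  have "fps_X = f * u" by (subst f) (simp only: mult.assoc u[symmetric] mult_1_right)
  show ?thesis
  proof
    assume "fps_nth a 0 = 0"
    hence "a = f * (u * fps_shift 1 a)"
      using fps_X_times_shift[of a] by (simp flip: mult.assoc \<open>fps_X = f * u\<close>)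
    thus "f dvd a" by (metis dvd_triv_left)
  qed (auto simp: assms(2) elim!: dvdE)
qed

lemma irreducible_imp_prime:
  fixes f :: "'k::alg_closed_field poly fps"
  assumes "Factorial_Ring.irreducible f" "f dvd a * b"
  shows "f dvd a \<or> f dvd b"
proof (cases "fps_nth f 0 = 0")
  case True
  with assms show ?thesis by (simp add: irreducible_nth_0_eq_0)
next
  case False
  from branch_exists[OF assms(1) this] obtain \<phi> :: "'k poly fps \<Rightarrow> 'k fps fract alg_closure"
    where "branch \<phi> f" by blast
  from branch.f_prime[OF this assms(2)] show ?thesis .
qed

text \<open>
  Finite codimension is available if the first generator does not vanish at \<open>y = 0\<close>; if \<open>f\<close> does
  vanish there, the symmetry of the ideal \<open>(f,g)\<close> allows one to exchange the roles.
\<close>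

lemma fin_codim_irreducible:
  fixes f g :: "'k::alg_closed_field poly fps"
  assumes f: "Factorial_Ring.irreducible f" and g: "Factorial_Ring.irreducible g" and nd: "\<not> f dvd g"
  shows "ka.fin_codim (ideal2 f g)"
proof (cases "fps_nth f 0 = 0")
  case False
  from branch_exists[OF f this] obtain \<phi> :: "'k poly fps \<Rightarrow> 'k fps fract alg_closure"
    where "branch \<phi> f" by blast
  from branch.fin_codim[OF this nd] show ?thesis .
next
  case True
  hence g0: "fps_nth g 0 \<noteq> 0" using nd f by (simp add: irreducible_nth_0_eq_0)
  from branch_exists[OF g this] obtain \<phi> :: "'k poly fps \<Rightarrow> 'k fps fract alg_closure"
    where b: "branch \<phi> g" by blast
  have "\<not> g dvd f"
  proof
    assume "g dvd f"
    then obtain c where c: "f = g * c" by (elim dvdE)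
    hence "fps_nth c 0 = 0" using True g0 by simp
    hence "f dvd c" using f True by (simp add: irreducible_nth_0_eq_0)
    then obtain d where "c = f * d" by (elim dvdE)
    with c have "f * (g * d) = f * 1" by (simp add: mult_ac)
    hence "g * d = 1" using f by (subst (asm) mult_cancel_left) (auto simp: Factorial_Ring.irreducible_def)
    hence "g dvd 1" by (metis dvd_triv_left)
    with g show False by (simp add: Factorial_Ring.irreducible_def)
  qed
  from branch.fin_codim[OF b this] show ?thesis by (simp add: ideal2_commute)
qed

text \<open>Otherwise \<open>g(x,0)\<close> would split into two coprime factors that are not units, and so would \<open>g\<close>.\<close>

lemma irreducible_nth_0_linear_power:
  fixes g :: "'k::alg_closed_field poly fps"
  assumes g: "Factorial_Ring.irreducible g" and g0: "fps_nth g 0 \<noteq> 0"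
  obtains e c where "fps_nth g 0 = smult e ([:- c, 1:] ^ degree (fps_nth g 0))"
proof -
  define r where "r = fps_nth g 0"
  have "degree r > 0"
  proof (rule ccontr)
    assume "\<not> degree r > 0"
    with g0 have "g dvd 1" by (simp add: fps_dvd_1_iff is_unit_iff_degree r_def)
    with g show False by (simp add: Factorial_Ring.irreducible_def)
  qed
  from alg_closed_imp_poly_has_root[OF this] obtain c where c: "poly r c = 0" by blast
  define m where "m = order c r"
  have r: "r \<noteq> 0" using g0 by (simp add: r_def)
  from order_decomp[OF r, of c] obtain u where
    u: "r = [:- c, 1:] ^ m * u" "\<not> [:- c, 1:] dvd u" by (auto simp: m_def)
  have "m > 0" using c r by (simp add: m_def order_gt_0_iff)
  have dm: "degree ([:- c, 1:] ^ m) = m" by (simp add: degree_power_eq)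
  have "poly u c \<noteq> 0" using u(2) by (simp add: poly_eq_0_iff_dvd)
  then obtain s t where "s * u + t * [:- c, 1:] ^ m = 1" by (rule bezout_root_power)
  moreover have "fps_nth g 0 = u * [:- c, 1:] ^ m" using u(1) by (simp add: r_def mult.commute)
  moreover have "[:- c, 1:] ^ m \<noteq> 0" by simp
  ultimately obtain U V where UV: "g = U * V" "fps_nth U 0 = u" "fps_nth V 0 = [:- c, 1:] ^ m"
    using hensel_factorization by metis
  have "\<not> V dvd 1"
    using \<open>m > 0\<close> by (simp add: fps_dvd_1_iff UV(3) is_unit_iff_degree dm)
  with irreducibleD[OF g UV(1)] have "u dvd 1" by (simp add: fps_dvd_1_iff UV(2))
  then obtain e where e: "u = [:e:]" by (auto simp: is_unit_poly_iff)
  with r u(1) have "e \<noteq> 0" by auto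
  with e have "degree r = m" unfolding u(1) by (simp add: dm degree_mult_eq)
  with u(1) e show ?thesis by (intro that[of e c]) (simp add: r_def)
qed

text \<open>
  The intersection number of \<open>f\<close> and \<open>g\<close> is divisible by \<open>q\<close> when calculated on \<open>g\<close>, and this is what
  is needed on \<open>f\<close>.
\<close>

theorem power_reciprocity:
  fixes f g h :: "'k::alg_closed_field poly fps"
  assumes q: "q > 0" "of_nat q \<noteq> (0 :: 'k)"
    and f: "Factorial_Ring.irreducible f" and g: "Factorial_Ring.irreducible g" and h: "g dvd f - h ^ q"
  shows "\<exists>a b. \<not> f dvd b \<and> f dvd g * b ^ q - a ^ q"
proof (cases "f dvd g")
  case True
  have "\<not> f dvd 1" using f by (simp add: Factorial_Ring.irreducible_def)
  with True q(1) show ?thesis by (intro exI[of _ 0] exI[of _ 1]) (simp add: power_0_left)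
next
  case False
  have "\<not> g dvd f"
  proof
    assume "g dvd f"
    then obtain c where c: "f = g * c" by (elim dvdE)
    from irreducibleD[OF f c] g have "c dvd 1" by (auto simp: Factorial_Ring.irreducible_def)
    then obtain c' where "1 = c * c'" by (elim dvdE)
    hence "g = f * c'" by (simp add: c mult.assoc)
    with False show False by simp
  qed
  hence gh: "\<not> g dvd h"
    using h q(1) by (metis diff_add_cancel dvd_add dvd_power dvd_trans)
  have ideals: "ideal2 f g = ideal2 g (h ^ q)"
    using ideal2_cong[OF h] by (simp add: ideal2_commute)
  have fin: "ka.fin_codim (ideal2 g (h ^ q))"
    using fin_codim_irreducible[OF f g False] by (simp add: ideals)
  have "ideal2 g (h ^ q) \<subseteq> ideal2 g h"
    using ideal2_mult_subset[of g h "h ^ (q - 1)"] q(1) by (simp add: power_eq_if)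
  from ka.fin_codim_mono[OF ideal_set_ideal2 ideal_set_ideal2 this fin]
  have "ka.fin_codim (ideal2 g h)" .
  from ka.codim_power[OF irreducible_imp_prime[OF g] gh this, of q]
  have dvd: "q dvd ka.codim (ideal2 f g)" by (simp add: ideals)
  show ?thesis
  proof (cases "fps_nth f 0 = 0")
    case f0: False
    from branch_exists[OF f this] obtain \<phi> :: "'k poly fps \<Rightarrow> 'k fps fract alg_closure"
      where "branch \<phi> f" by blast
    from branch.power_residue_if_len_dvd[OF this False dvd q(2)] show ?thesis .
  next
    case f0: True
    note dvd_iff = irreducible_nth_0_eq_0[OF f f0]
    have g0: "fps_nth g 0 \<noteq> 0" using False by (simp add: dvd_iff)
    from branch_exists[OF g this] obtain \<phi> :: "'k poly fps \<Rightarrow> 'k fps fract alg_closure"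
      where b: "branch \<phi> g" by blast
    have "ideal2 f g = ideal2 g fps_X"
    proof -
      have "f dvd fps_X" by (simp add: dvd_iff)
      moreover have "fps_X dvd f" using fps_X_times_shift[OF f0] by (metis dvd_triv_left)
      ultimately have "ideal2 f g = ideal2 fps_X g"
        unfolding set_eq_iff ideal2_iff by (meson dvd_trans)
      thus ?thesis by (simp add: ideal2_commute)
    qed
    with dvd have "q dvd degree (fps_nth g 0)"
      by (simp add: branch.len_X[OF b] branch.n_def[OF b])
    then obtain m where m: "degree (fps_nth g 0) = m * q" by (metis dvd_def mult.commute)
    obtain e c where e: "fps_nth g 0 = smult e ([:- c, 1:] ^ (m * q))"
      using irreducible_nth_0_linear_power[OF g g0] m by metis
    obtain d where "d ^ q = e" using nth_root_exists[OF q(1)] by blast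
    hence "fps_nth g 0 = smult d ([:- c, 1:] ^ m) ^ q" by (simp add: e smult_power power_mult)
    hence "f dvd g * 1 ^ q - fps_const (smult d ([:- c, 1:] ^ m)) ^ q"
      by (simp add: dvd_iff fps_power_zeroth)
    moreover have "\<not> f dvd 1" by (simp add: dvd_iff)
    ultimately show ?thesis by blast
  qed
qed

section \<open>Roots in the normalization of the quotient\<close>

lemma type_ring_simps [simp]:
  "carrier (ring_of_type_algebra :: 'a::comm_ring_1 ring) = UNIV"
  "x \<otimes>\<^bsub>ring_of_type_algebra\<^esub> y = x * (y :: 'a)"
  "x \<oplus>\<^bsub>ring_of_type_algebra\<^esub> y = x + (y :: 'a)"
  "\<one>\<^bsub>ring_of_type_algebra\<^esub> = (1 :: 'a)"
  "\<zero>\<^bsub>ring_of_type_algebra\<^esub> = (0 :: 'a)"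
  by (simp_all add: ring_of_type_algebra_def)

lemma type_ring_power: "x [^]\<^bsub>ring_of_type_algebra\<^esub> (m::nat) = (x :: 'a::comm_ring_1) ^ m"
  by (induction m) (simp_all add: mult.commute)

lemma type_ring_minus: "a \<ominus>\<^bsub>ring_of_type_algebra\<^esub> b = a - (b :: 'a::comm_ring_1)"
proof -
  interpret cring "ring_of_type_algebra :: 'a ring" by (rule cring_from_type_algebra)
  have "(a \<ominus>\<^bsub>ring_of_type_algebra\<^esub> b) \<oplus>\<^bsub>ring_of_type_algebra\<^esub> b = a"
    by (simp add: a_minus_def a_assoc l_neg del: type_ring_simps(3))
  thus ?thesis by (simp add: algebra_simps)
qed

lemma mem_principal_ideal: "x \<in> PIdl\<^bsub>ring_of_type_algebra\<^esub> f \<longleftrightarrow> f dvd (x :: 'a::comm_ring_1)"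
  by (auto simp: cgenideal_def dvd_def mult.commute)

lemma residue_class_hom:
  "residue_class f \<in> ring_hom ring_of_type_algebra (quotient_by (f :: 'a::comm_ring_1))"
proof -
  interpret cring "ring_of_type_algebra :: 'a ring" by (rule cring_from_type_algebra)
  have "ideal (PIdl\<^bsub>ring_of_type_algebra\<^esub> f) (ring_of_type_algebra :: 'a ring)"
    by (rule cgenideal_ideal) simp
  from ideal.rcos_ring_hom[OF this] show ?thesis
    by (simp add: residue_class_def[abs_def] quotient_by_def)
qed

lemma residue_class_eq_iff:
  "residue_class f a = residue_class f b \<longleftrightarrow> f dvd a - (b :: 'a::comm_ring_1)"
proof -
  interpret cring "ring_of_type_algebra :: 'a ring" by (rule cring_from_type_algebra)
  have "ideal (PIdl\<^bsub>ring_of_type_algebra\<^esub> f) (ring_of_type_algebra :: 'a ring)"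
    by (rule cgenideal_ideal) simp
  from quotient_eq_iff_same_a_r_cos[OF this, of a b] show ?thesis
    by (simp add: residue_class_def type_ring_minus mem_principal_ideal)
qed

lemma domain_quotient_by:
  fixes f :: "'a::comm_ring_1"
  assumes prime: "\<And>a b. f dvd a * b \<Longrightarrow> f dvd a \<or> f dvd b" and nu: "\<not> f dvd 1"
  shows "domain (quotient_by f)"
proof -
  interpret cring "ring_of_type_algebra :: 'a ring" by (rule cring_from_type_algebra)
  have "primeideal (PIdl\<^bsub>ring_of_type_algebra\<^esub> f) (ring_of_type_algebra :: 'a ring)"
  proof (rule primeidealI)
    show "ideal (PIdl\<^bsub>ring_of_type_algebra\<^esub> f) (ring_of_type_algebra :: 'a ring)"
      by (rule cgenideal_ideal) simp
    show "cring (ring_of_type_algebra :: 'a ring)" by unfold_locales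
    show "carrier ring_of_type_algebra \<noteq> PIdl\<^bsub>ring_of_type_algebra\<^esub> f"
      using nu mem_principal_ideal[of 1 f] by auto
  qed (use prime in \<open>auto simp: mem_principal_ideal\<close>)
  thus ?thesis unfolding quotient_by_def by (rule primeideal.quotient_is_domain)
qed

context domain
begin

lemma fraction_pow:
  assumes "(a, b) \<in> frac_pairs R"
  shows "fraction R a b [^]\<^bsub>fraction_field R\<^esub> (m::nat) = fraction R (a [^] m) (b [^] m) \<and>
    (a [^] m, b [^] m) \<in> frac_pairs R"
proof (induction m)
  case 0
  show ?case by (simp add: fraction_field_one frac_pairs_iff)
next
  case (Suc m)
  then show ?case using assms by (auto simp: frac_mult frac_pairs_iff integral_iff)
qed

text \<open>A fraction whose \<open>q\<close>-th power is \<open>G\<close> satisfies the monic equation \<open>X\<^sup>q - G = 0\<close>.\<close>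

lemma root_in_normalization:
  assumes G: "G \<in> carrier R" and ab: "(a, b) \<in> frac_pairs R" and q: "q > 0"
    and eq: "G \<otimes> b [^] q = a [^] (q::nat)"
  shows "\<exists>s\<in>carrier (normalization R). s [^]\<^bsub>normalization R\<^esub> q = frac_embed R G"
proof -
  let ?F = "fraction_field R"
  interpret F: field ?F by (rule field_fraction_field)
  define s where "s = fraction R a b"
  have sF: "s \<in> carrier ?F" using ab by (simp add: s_def frac_in_carrier)
  have pow: "s [^]\<^bsub>?F\<^esub> q = frac_embed R G"
    unfolding s_def frac_embed_def
    using fraction_pow[OF ab, of q] G eq by (auto simp: frac_eq_iff frac_pairs_iff)
  have EG: "frac_embed R G \<in> carrier ?F" using G frac_embed_hom by (rule ring_hom_closed[rotated])
  define c where "c i = (if i = (0::nat) then frac_embed R (\<ominus> G) else frac_embed R \<zero>)" for i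
  interpret h: ring_hom_ring R ?F "frac_embed R"
    by (rule ring_hom_ringI2) (use frac_embed_hom in \<open>unfold_locales; simp\<close>)+
  have c: "c i \<otimes>\<^bsub>?F\<^esub> s [^]\<^bsub>?F\<^esub> i = (if 0 = i then \<ominus>\<^bsub>?F\<^esub> frac_embed R G else \<zero>\<^bsub>?F\<^esub>)" for i
    using sF G EG by (auto simp: c_def)
  have "(\<Oplus>\<^bsub>?F\<^esub>i\<in>{..<q}. c i \<otimes>\<^bsub>?F\<^esub> s [^]\<^bsub>?F\<^esub> i) = \<ominus>\<^bsub>?F\<^esub> frac_embed R G"
    unfolding c using F.add.finprod_singleton[of 0 "{..<q}" "\<lambda>_. \<ominus>\<^bsub>?F\<^esub> frac_embed R G"] q EG by simp
  hence "s [^]\<^bsub>?F\<^esub> q \<oplus>\<^bsub>?F\<^esub> (\<Oplus>\<^bsub>?F\<^esub>i\<in>{..<q}. c i \<otimes>\<^bsub>?F\<^esub> s [^]\<^bsub>?F\<^esub> i) = \<zero>\<^bsub>?F\<^esub>"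
    using EG by (simp add: pow F.r_neg)
  moreover have "c \<in> {..<q} \<rightarrow> frac_embed R ` carrier R" using G by (auto simp: c_def simp del: h.hom_a_inv h.hom_zero)
  ultimately have "integral_over ?F (frac_embed R ` carrier R) s"
    using sF unfolding integral_over_def by blast
  hence "s \<in> carrier (normalization R)" by (simp add: normalization_def)
  moreover have "s [^]\<^bsub>normalization R\<^esub> q = s [^]\<^bsub>?F\<^esub> q"
    by (simp add: nat_pow_def normalization_def)
  ultimately show ?thesis using pow by auto
qed

end

theorem proposition3p7:
  fixes f g :: "'k::alg_closed_field poly fps" and q :: nat
  assumes "Factorial_Ring.prime q" and "q \<noteq> CHAR('k)"
    and "f \<noteq> 0" and "g \<noteq> 0"
    and "Factorial_Ring.irreducible f" and "Factorial_Ring.irreducible g"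
    and "\<exists>h. g dvd f - h ^ q"
  shows "(\<exists>s\<in>carrier (normalization (quotient_by f)).
            s [^]\<^bsub>normalization (quotient_by f)\<^esub> q
              = frac_embed (quotient_by f) (residue_class f g))
         \<and> (\<exists>s t :: 'k poly fps fract.
               Fraction_Field.Fract g 1 - s ^ q = Fraction_Field.Fract f 1 * t)"
proof
  have q: "q > 0" using assms(1) by (simp add: prime_gt_0_nat)
  have "\<not> CHAR('k) dvd q"
    using assms(1,2) CHAR_not_1'[where 'a = 'k] by (metis One_nat_def prime_nat_iff)
  hence "of_nat q \<noteq> (0 :: 'k)" by (simp add: of_nat_eq_0_iff_char_dvd)
  with power_reciprocity[OF q _ assms(5,6)] assms(7) obtain a b where
    ab: "\<not> f dvd b" "f dvd g * b ^ q - a ^ q" by blast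
  have "\<not> f dvd 1" using assms(5) by (simp add: Factorial_Ring.irreducible_def)
  then interpret D: domain "quotient_by f"
    using domain_quotient_by irreducible_imp_prime[OF assms(5)] by blast
  interpret R: cring "ring_of_type_algebra :: 'k poly fps ring" by (rule cring_from_type_algebra)
  interpret cls: ring_hom_ring ring_of_type_algebra "quotient_by f" "residue_class f"
    by (rule ring_hom_ringI2[OF R.ring_axioms D.ring_axioms residue_class_hom])
  have cl: "residue_class f z \<in> carrier (quotient_by f)" for z using cls.hom_closed[of z] by simp
  have "residue_class f b \<noteq> \<zero>\<^bsub>quotient_by f\<^esub>"
    using ab(1) cls.hom_zero residue_class_eq_iff[of f b 0] by simp
  hence pair: "(residue_class f a, residue_class f b) \<in> frac_pairs (quotient_by f)"
    by (simp add: D.frac_pairs_iff cl)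
  have pow: "residue_class f z [^]\<^bsub>quotient_by f\<^esub> q = residue_class f (z ^ q)" for z
    using cls.hom_nat_pow[of z q] by (simp add: type_ring_power)
  have "residue_class f (g * b ^ q) = residue_class f (a ^ q)"
    using ab(2) by (simp add: residue_class_eq_iff)
  hence "residue_class f g \<otimes>\<^bsub>quotient_by f\<^esub> residue_class f b [^]\<^bsub>quotient_by f\<^esub> q
      = residue_class f a [^]\<^bsub>quotient_by f\<^esub> q"
    unfolding pow using cls.hom_mult[of g "b ^ q"] by simp
  from D.root_in_normalization[OF cl pair q this]
  show "\<exists>s\<in>carrier (normalization (quotient_by f)).
      s [^]\<^bsub>normalization (quotient_by f)\<^esub> q = frac_embed (quotient_by f) (residue_class f g)" .
next
  have "q > 0" using assms(1) by (simp add: prime_gt_0_nat)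
  hence "Fraction_Field.Fract g 1 - 0 ^ q = Fraction_Field.Fract f 1 * Fraction_Field.Fract g f"
    using assms(3) by (simp add: power_0_left eq_fract mult.commute)
  thus "\<exists>s t :: 'k poly fps fract. Fraction_Field.Fract g 1 - s ^ q = Fraction_Field.Fract f 1 * t"
    by blast
qed

end
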